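(* Let $M\models REF$ be arbitrary and let $\mathcal{A}=\{D_i:i\in I\}$ be a set of $\emptyset$-definable subsets $D_i\subseteq M^{k_i}$ for various $k_i$. Then there is a subset $J\subseteq\omega$ such that $\mathcal{A}$ and $\{E_j:j\in J\}$ are $\emptyset$-definably equivalent.
   Context: $REF$ is the (incomplete) theory in the language $\mathcal{L}=\{E_n:n\in\omega\}$ of binary relation symbols asserting that each $E_n$ is an equivalence relation, that $E_{n+1}$ refines $E_n$ (i.e. $E_{n+1}(x,y)\to E_n(x,y)$) for each $n$, and that there is a function $\delta:\omega\to\{2,3,\dots,\infty\}$ specifying the number of classes into which $E_{n+1}$ partitions each $E_n$-class (i.e., each $E_n$-class is partitioned into exactly $\delta(n)$ $E_{n+1}$-classes if that number is finite, and into infinitely many otherwise). Infinite splitting is allowed. Two families $\mathcal{A}=\{D_i:i\in I\}$ and $\mathcal{A}'=\{D'_j:j\in J\}$ of subsets of finite powers of a non-empty set $M$ are $\emptyset$-definably equivalent if every $D'_j$ is $\emptyset$-definable (by a first-order formula with equality, without parameters) in the structure $(M,D_i:i\in I)$ and every $D_i$ is $\emptyset$-definable in the structure $(M,D'_j:j\in J)$. *)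

theory Defs
  imports Main "HOL-Library.Extended_Nat"
begin

text \<open>First-order formulas with equality, over relation symbols of type \<open>'r\<close>; variables are
  natural numbers.  A language is a set of symbols together with an arity function.\<close>

datatype 'r fm =
    Eq nat nat
  | Rel 'r "nat list"
  | Neg "'r fm"
  | Conj "'r fm" "'r fm"
  | Ex nat "'r fm"

primrec fv :: "'r fm \<Rightarrow> nat set" where
  "fv (Eq x y) = {x, y}"
| "fv (Rel r xs) = set xs"
| "fv (Neg \<phi>) = fv \<phi>"
| "fv (Conj \<phi> \<psi>) = fv \<phi> \<union> fv \<psi>"
| "fv (Ex x \<phi>) = fv \<phi> - {x}"

primrec in_language :: "'r set \<Rightarrow> ('r \<Rightarrow> nat) \<Rightarrow> 'r fm \<Rightarrow> bool" where
  "in_language L ar (Eq x y) \<longleftrightarrow> True"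
| "in_language L ar (Rel r xs) \<longleftrightarrow> r \<in> L \<and> length xs = ar r"
| "in_language L ar (Neg \<phi>) \<longleftrightarrow> in_language L ar \<phi>"
| "in_language L ar (Conj \<phi> \<psi>) \<longleftrightarrow> in_language L ar \<phi> \<and> in_language L ar \<psi>"
| "in_language L ar (Ex x \<phi>) \<longleftrightarrow> in_language L ar \<phi>"

primrec sat :: "'a set \<Rightarrow> ('r \<Rightarrow> 'a list set) \<Rightarrow> (nat \<Rightarrow> 'a) \<Rightarrow> 'r fm \<Rightarrow> bool" where
  "sat M D v (Eq x y) \<longleftrightarrow> v x = v y"
| "sat M D v (Rel r xs) \<longleftrightarrow> map v xs \<in> D r"
| "sat M D v (Neg \<phi>) \<longleftrightarrow> \<not> sat M D v \<phi>"
| "sat M D v (Conj \<phi> \<psi>) \<longleftrightarrow> sat M D v \<phi> \<and> sat M D v \<psi>"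
| "sat M D v (Ex x \<phi>) \<longleftrightarrow> (\<exists>a\<in>M. sat M D (v(x := a)) \<phi>)"

definition tuples :: "'a set \<Rightarrow> nat \<Rightarrow> 'a list set" where
  "tuples M n = {xs. set xs \<subseteq> M \<and> length xs = n}"

text \<open>The ambient structure is \<open>(M, D i : i \<in> I)\<close> with \<open>D i\<close> of arity \<open>k i\<close>.  The free
  variables of the formula are among \<open>0, \<dots>, n - 1\<close>, so the unspecified values of
  \<open>nth xs\<close> beyond the length of \<open>xs\<close> play no role.\<close>

definition definable ::
  "'a set \<Rightarrow> 'i set \<Rightarrow> ('i \<Rightarrow> nat) \<Rightarrow> ('i \<Rightarrow> 'a list set) \<Rightarrow> nat \<Rightarrow> 'a list set \<Rightarrow> bool" where
  "definable M I k D n X \<longleftrightarrow>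
     (\<exists>\<phi>. in_language I k \<phi> \<and> fv \<phi> \<subseteq> {..<n} \<and> X = {xs \<in> tuples M n. sat M D (nth xs) \<phi>})"

definition definably_equivalent ::
  "'a set \<Rightarrow> 'i set \<Rightarrow> ('i \<Rightarrow> nat) \<Rightarrow> ('i \<Rightarrow> 'a list set) \<Rightarrow>
   'j set \<Rightarrow> ('j \<Rightarrow> nat) \<Rightarrow> ('j \<Rightarrow> 'a list set) \<Rightarrow> bool" where
  "definably_equivalent M I k D J k' D' \<longleftrightarrow>
     (\<forall>j\<in>J. definable M I k D (k' j) (D' j)) \<and>
     (\<forall>i\<in>I. definable M J k' D' (k i) (D i))"

definition ecard :: "'a set \<Rightarrow> enat" where
  "ecard A = (if finite A then enat (card A) else \<infinity>)"

text \<open>For an \<open>E n\<close>-class \<open>C\<close>, the quotient \<open>C // E (Suc n)\<close> is the set of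
  \<open>E (Suc n)\<close>-classes into which \<open>C\<close> is partitioned.  The number of \<open>E 0\<close>-classes is
  not constrained.\<close>

definition REF :: "'a set \<Rightarrow> (nat \<Rightarrow> ('a \<times> 'a) set) \<Rightarrow> bool" where
  "REF M E \<longleftrightarrow>
     M \<noteq> {} \<and>
     (\<forall>n. equiv M (E n)) \<and>
     (\<forall>n. E (Suc n) \<subseteq> E n) \<and>
     (\<exists>\<delta> :: nat \<Rightarrow> enat. (\<forall>n. 2 \<le> \<delta> n) \<and>
        (\<forall>n. \<forall>C \<in> M // E n. ecard (C // E (Suc n)) = \<delta> n))"

definition pairs :: "('a \<times> 'a) set \<Rightarrow> 'a list set" where
  "pairs R = {[x, y] | x y. (x, y) \<in> R}"

end

(*
  A formula mentions only E_0, ..., E_n, and the reduct to these levels is elementarily equivalent,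
  by back-and-forth, to a tree of sequences with the same splitting numbers.  The tree has honest
  automorphisms: the swaps of two subtrees.  For a relation X on the tree and a height j, let x ~ y
  hold if swapping the height-j subtrees of x and y preserves X.  This is an equivalence relation
  invariant under automorphisms, hence agreement below some height f(j), and f(j) < j if j > 0.
  Starting from equality and iterating f gives a set J of heights.  The swaps of adjacent
  J-levels preserve X and act transitively on tuples of the same J-type, so X is definable from
  the levels in J.  Conversely level f(j) is definable from X and the levels of J from j
  downwards in the tree, because up to J-type a swap is described by these levels.
*)

theory Submission
  imports Defs
begin

section \<open>Expressible predicates of valuations\<close>

text \<open>A model of REF may lack the automorphisms that the argument wants: the classes of the
  intersection of all \<open>E n\<close> can differ in size, so two classes of one
  \<open>E n\<close> need not be exchangeable. This is why the relations are handled one at a time: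
  a single formula sees finitely many levels, and these can be copied by finite sequences, where any
  two subtrees at equal height look alike. The copied chain is closed off by the two relations that
  first-order logic has without any symbol, the total relation at height 0 and equality at the
  bottom height \<open>N\<close>. They give the iteration a free start and a free end; only the
  heights strictly between them contribute some \<open>E j\<close>. The number of
  \<open>E 0\<close>-classes becomes one more splitting number. Infinite cardinals are not told
  apart, since only finite tuples are compared.\<close>

definition expressible ::
  "'a set \<Rightarrow> 'r set \<Rightarrow> ('r \<Rightarrow> nat) \<Rightarrow> ('r \<Rightarrow> 'a list set) \<Rightarrow> ((nat \<Rightarrow> 'a) \<Rightarrow> bool) \<Rightarrow> bool" where
  "expressible M L ar D P \<longleftrightarrow>
     (\<exists>\<phi>. in_language L ar \<phi> \<and> (\<forall>v. (\<forall>i. v i \<in> M) \<longrightarrow> sat M D v \<phi> = P v))"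

lemma sat_cong_fv:
  assumes "\<And>x. x \<in> fv \<phi> \<Longrightarrow> v x = w x"
  shows "sat M D v \<phi> = sat M D w \<phi>"
  using assms
proof (induction \<phi> arbitrary: v w)
  case (Rel r xs)
  then have "map v xs = map w xs" by simp
  then show ?case by (simp del: map_eq_conv)
next
  case (Neg \<phi>)
  have "sat M D v \<phi> = sat M D w \<phi>" by (rule Neg.IH) (simp add: Neg.prems)
  then show ?case by simp
next
  case (Conj \<phi> \<psi>)
  have "sat M D v \<phi> = sat M D w \<phi>" by (rule Conj.IH(1)) (simp add: Conj.prems)
  moreover have "sat M D v \<psi> = sat M D w \<psi>" by (rule Conj.IH(2)) (simp add: Conj.prems)
  ultimately show ?case by simp
next
  case (Ex x \<phi>)
  have "sat M D (v(x := a)) \<phi> = sat M D (w(x := a)) \<phi>" for a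
    by (rule Ex.IH) (simp add: Ex.prems)
  then show ?case by simp
qed simp_all

lemma finite_fv [simp]: "finite (fv \<phi>)"
  by (induction \<phi>) auto

lemma in_language_mono:
  "in_language L ar \<phi> \<Longrightarrow> L \<subseteq> L' \<Longrightarrow> in_language L' ar \<phi>"
  by (induction \<phi>) auto

lemma in_language_finite_support:
  "in_language (UNIV :: nat set) ar \<phi> \<Longrightarrow> \<exists>n. in_language {..n} ar \<phi>"
proof (induction \<phi>)
  case (Conj \<phi> \<psi>)
  then obtain m n where "in_language {..m} ar \<phi>" "in_language {..n} ar \<psi>" by auto
  then have "in_language {..max m n} ar \<phi>" "in_language {..max m n} ar \<psi>"
    by (auto elim!: in_language_mono)
  then show ?case by auto
qed auto

lemma definable_mono:
  "definable M L ar D n X \<Longrightarrow> L \<subseteq> L' \<Longrightarrow> definable M L' ar D n X"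
  unfolding definable_def by (blast intro: in_language_mono)

lemma expressible_cong:
  assumes "expressible M L ar D P" "\<And>v. (\<And>i. v i \<in> M) \<Longrightarrow> P v = Q v"
  shows "expressible M L ar D Q"
  using assms unfolding expressible_def by metis

lemma expressible_not:
  assumes "expressible M L ar D P"
  shows "expressible M L ar D (\<lambda>v. \<not> P v)"
proof -
  obtain \<phi> where "in_language L ar \<phi>" "\<forall>v. (\<forall>i. v i \<in> M) \<longrightarrow> sat M D v \<phi> = P v"
    using assms unfolding expressible_def by blast
  then show ?thesis unfolding expressible_def by (intro exI[of _ "Neg \<phi>"]) simp
qed

lemma expressible_conj:
  assumes "expressible M L ar D P" "expressible M L ar D Q"
  shows "expressible M L ar D (\<lambda>v. P v \<and> Q v)"
proof -
  obtain \<phi> where "in_language L ar \<phi>" "\<forall>v. (\<forall>i. v i \<in> M) \<longrightarrow> sat M D v \<phi> = P v"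
    using assms unfolding expressible_def by blast
  moreover obtain \<psi> where "in_language L ar \<psi>" "\<forall>v. (\<forall>i. v i \<in> M) \<longrightarrow> sat M D v \<psi> = Q v"
    using assms unfolding expressible_def by blast
  ultimately show ?thesis unfolding expressible_def by (intro exI[of _ "Conj \<phi> \<psi>"]) simp
qed

lemma expressible_eq: "expressible M L ar D (\<lambda>v. v a = v b)"
  unfolding expressible_def by (intro exI[of _ "Eq a b"]) simp

lemma expressible_rel:
  assumes "r \<in> L" "length xs = ar r"
  shows "expressible M L ar D (\<lambda>v. map v xs \<in> D r)"
  unfolding expressible_def using assms by (intro exI[of _ "Rel r xs"]) simp

lemma expressible_const: "expressible M L ar D (\<lambda>v. c)"
proof (cases c)
  case True
  then show ?thesis using expressible_eq[of M L ar D 0 0] by simp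
next
  case False
  then show ?thesis using expressible_not[OF expressible_eq[of M L ar D 0 0]] by simp
qed

lemma expressible_ex1:
  assumes "expressible M L ar D P"
  shows "expressible M L ar D (\<lambda>v. \<exists>a\<in>M. P (v(x := a)))"
proof -
  obtain \<phi> where "in_language L ar \<phi>" "\<forall>v. (\<forall>i. v i \<in> M) \<longrightarrow> sat M D v \<phi> = P v"
    using assms unfolding expressible_def by blast
  then show ?thesis unfolding expressible_def by (intro exI[of _ "Ex x \<phi>"]) simp
qed

text \<open>The block \<open>A\<close> will hold the entries of two \<open>k\<close>-tuples that are
  quantified together.\<close>

lemma expressible_ex:
  fixes M :: "'a set"
  assumes "finite A" "expressible M L ar D P"
  shows "expressible M L ar D (\<lambda>v. \<exists>w. (\<forall>i. w i \<in> M) \<and> (\<forall>i. i \<notin> A \<longrightarrow> w i = v i) \<and> P w)"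
  using assms(1)
proof (induction A rule: finite_induct)
  case empty
  show ?case
    by (rule expressible_cong[OF assms(2)]) (metis empty_iff ext)
next
  case (insert x A)
  show ?case
  proof (rule expressible_cong[OF expressible_ex1[OF insert.IH, of x]])
    fix v :: "nat \<Rightarrow> 'a"
    assume v: "\<And>i. v i \<in> M"
    show "(\<exists>a\<in>M. \<exists>w. (\<forall>i. w i \<in> M) \<and> (\<forall>i. i \<notin> A \<longrightarrow> w i = (v(x := a)) i) \<and> P w)
        = (\<exists>w. (\<forall>i. w i \<in> M) \<and> (\<forall>i. i \<notin> insert x A \<longrightarrow> w i = v i) \<and> P w)" (is "?l = ?r")
    proof
      assume ?l
      then obtain a w where "a \<in> M" "\<forall>i. w i \<in> M" "\<forall>i. i \<notin> A \<longrightarrow> w i = (v(x := a)) i" "P w"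
        by blast
      then show ?r by (intro exI[of _ w]) auto
    next
      assume ?r
      then obtain w where "\<forall>i. w i \<in> M" "\<forall>i. i \<notin> insert x A \<longrightarrow> w i = v i" "P w" by blast
      then show ?l by (intro bexI[of _ "w x"] exI[of _ w]) auto
    qed
  qed
qed

text \<open>Finitely many truth values decide \<open>P\<close>, so \<open>P\<close> is a Boolean
  combination of the \<open>Q a\<close>; the induction expands it along one \<open>Q x\<close> at a
  time.\<close>

lemma expressible_determined:
  fixes M :: "'a set"
  assumes "finite A" "\<And>a. a \<in> A \<Longrightarrow> expressible M L ar D (Q a)"
    and "\<And>v w. (\<And>i. v i \<in> M) \<Longrightarrow> (\<And>i. w i \<in> M) \<Longrightarrow> (\<And>a. a \<in> A \<Longrightarrow> Q a v = Q a w) \<Longrightarrow> P v = P w"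
  shows "expressible M L ar D P"
  using assms
proof (induction A arbitrary: P rule: finite_induct)
  case empty
  have "expressible M L ar D (\<lambda>v. \<exists>w. (\<forall>i. w i \<in> M) \<and> P w)" by (rule expressible_const)
  then show ?case
    by (rule expressible_cong) (use empty in blast)
next
  case (insert x A)
  \<comment> \<open>The two cofactors of \<open>P\<close> at \<open>Q x\<close>. Quantifying over
    \<open>w\<close> makes \<open>R c\<close> depend on the \<open>Q a\<close> with
    \<open>a \<in> A\<close> alone, even at valuations where \<open>Q x\<close> has the other
    value.\<close>
  define R where "R c v \<longleftrightarrow> (\<exists>w. (\<forall>i. w i \<in> M) \<and> Q x w = c \<and> (\<forall>a\<in>A. Q a v = Q a w) \<and> P w)" for c v
  have R: "expressible M L ar D (R c)" for c
    by (rule insert.IH) (auto simp: R_def insert.prems(1))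
  have Qx: "expressible M L ar D (Q x)" by (simp add: insert.prems(1))
  have "expressible M L ar D (\<lambda>v. \<not> (\<not> (Q x v \<and> R True v) \<and> \<not> (\<not> Q x v \<and> R False v)))"
    by (intro expressible_not expressible_conj R Qx)
  then show ?case
  proof (rule expressible_cong)
    fix v :: "nat \<Rightarrow> 'a"
    assume v: "\<And>i. v i \<in> M"
    have "R (Q x v) v = P v"
    proof
      assume "R (Q x v) v"
      then obtain w where "\<forall>i. w i \<in> M" "Q x w = Q x v" "\<forall>a\<in>A. Q a v = Q a w" "P w"
        unfolding R_def by blast
      then show "P v" using insert.prems(2)[of v w] v by auto
    next
      assume "P v"
      then show "R (Q x v) v" unfolding R_def using v by blast
    qed
    then show "(\<not> (\<not> (Q x v \<and> R True v) \<and> \<not> (\<not> Q x v \<and> R False v))) = P v"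
      by (cases "Q x v") auto
  qed
qed

text \<open>An expressing formula may have free variables from \<open>n\<close> on. Its truth does
  not depend on their values in \<open>M\<close>, so each can be bound by an existential quantifier;
  \<open>M \<noteq> {}\<close> supplies the witness.\<close>

lemma definable_if_expressible:
  assumes M: "M \<noteq> {}" and P: "expressible M L ar D P"
    and dep: "\<And>v w. (\<And>i. v i \<in> M) \<Longrightarrow> (\<And>i. w i \<in> M) \<Longrightarrow> (\<And>i. i < n \<Longrightarrow> v i = w i) \<Longrightarrow> P v = P w"
    and X: "X \<subseteq> tuples M n" "\<And>v. (\<And>i. v i \<in> M) \<Longrightarrow> map v [0..<n] \<in> X \<longleftrightarrow> P v"
  shows "definable M L ar D n X"
proof -
  obtain \<phi> where \<phi>: "in_language L ar \<phi>" "\<forall>v. (\<forall>i. v i \<in> M) \<longrightarrow> sat M D v \<phi> = P v"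
    using P unfolding expressible_def by blast
  have "\<exists>\<psi>. in_language L ar \<psi> \<and> fv \<psi> \<subseteq> fv \<phi> - A \<and>
          (\<forall>v. (\<forall>i. v i \<in> M) \<longrightarrow> sat M D v \<psi> = P v)" if "finite A" "A \<inter> {..<n} = {}" for A
    using that
  proof (induction A rule: finite_induct)
    case empty
    then show ?case using \<phi> by auto
  next
    case (insert x A)
    then obtain \<psi> where \<psi>: "in_language L ar \<psi>" "fv \<psi> \<subseteq> fv \<phi> - A"
      "\<And>v. (\<forall>i. v i \<in> M) \<Longrightarrow> sat M D v \<psi> = P v" by auto
    have "sat M D v (Ex x \<psi>) = P v" if v: "\<forall>i. v i \<in> M" for v
    proof -
      have "sat M D (v(x := a)) \<psi> = P v" if "a \<in> M" for a
      proof -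
        have "sat M D (v(x := a)) \<psi> = P (v(x := a))" using v that by (intro \<psi>(3)) simp
        also have "\<dots> = P v" using v that insert.prems by (intro dep) auto
        finally show ?thesis .
      qed
      then show ?thesis using M by auto
    qed
    then show ?case using \<psi>(1,2) by (intro exI[of _ "Ex x \<psi>"]) auto
  qed
  from this[of "fv \<phi> - {..<n}"] obtain \<psi> where \<psi>: "in_language L ar \<psi>"
    "fv \<psi> \<subseteq> {..<n}" "\<And>v. (\<forall>i. v i \<in> M) \<Longrightarrow> sat M D v \<psi> = P v" by auto
  obtain c where c: "c \<in> M" using M by blast
  have "xs \<in> X \<longleftrightarrow> sat M D (nth xs) \<psi>" if xs: "xs \<in> tuples M n" for xs
  proof -
    \<comment> \<open>\<open>nth xs\<close> may leave \<open>M\<close> beyond the last entry. The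
      default \<open>c\<close> yields a valuation into \<open>M\<close>, for which
      \<open>\<psi>\<close> expresses \<open>P\<close>, and no free variable of
      \<open>\<psi>\<close> sees the change.\<close>
    define v where "v i = (if i < n then xs ! i else c)" for i
    have v: "\<forall>i. v i \<in> M" using xs c by (auto simp: v_def tuples_def)
    have "sat M D (nth xs) \<psi> = sat M D v \<psi>"
      by (rule sat_cong_fv) (use \<psi>(2) in \<open>auto simp: v_def\<close>)
    also have "\<dots> = P v" using v by (rule \<psi>(3))
    also have "\<dots> \<longleftrightarrow> map v [0..<n] \<in> X" using X(2) v by simp
    also have "map v [0..<n] = xs"
      using xs by (intro nth_equalityI) (auto simp: v_def tuples_def)
    finally show ?thesis by simp
  qed
  then have "X = {xs \<in> tuples M n. sat M D (nth xs) \<psi>}" using X(1) by blast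
  then show ?thesis unfolding definable_def using \<psi>(1,2) by blast
qed

section \<open>Uniformly splitting chains of equivalence relations\<close>

text \<open>Closed at both ends: the total relation gives any two points some common level, and
  equality at \<open>N\<close> lets the levels decide equality as well.\<close>

definition splitting_chain ::
  "'a set \<Rightarrow> (nat \<Rightarrow> ('a \<times> 'a) set) \<Rightarrow> nat \<Rightarrow> (nat \<Rightarrow> enat) \<Rightarrow> bool" where
  "splitting_chain M F N \<delta> \<longleftrightarrow>
     M \<noteq> {} \<and> F 0 = M \<times> M \<and> F N = Id_on M \<and> (\<forall>m\<le>N. equiv M (F m)) \<and>
     (\<forall>m<N. F (Suc m) \<subseteq> F m) \<and> (\<forall>m<N. \<forall>C \<in> M // F m. ecard (C // F (Suc m)) = \<delta> m)"

lemma splitting_chain_antimono: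
  assumes "splitting_chain M F N \<delta>" "m \<le> m'" "m' \<le> N"
  shows "F m' \<subseteq> F m"
  using assms(2,3)
proof (induction m' rule: dec_induct)
  case (step n)
  then have "F (Suc n) \<subseteq> F n" using assms(1) unfolding splitting_chain_def by simp
  then show ?case using step by simp
qed simp

section \<open>Back-and-forth between two chains with the same splitting numbers\<close>

definition same_type where
  "same_type N F F' S v v' \<longleftrightarrow>
     (\<forall>a\<in>S. \<forall>b\<in>S. \<forall>m\<le>N. (v a, v b) \<in> F m \<longleftrightarrow> (v' a, v' b) \<in> F' m)"

lemma splitting_chain_bottom: "splitting_chain M F N \<delta> \<Longrightarrow> F N = Id_on M"
  by (simp add: splitting_chain_def)

lemma equiv_commute: "equiv M R \<Longrightarrow> (a, b) \<in> R \<longleftrightarrow> (b, a) \<in> R"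
  unfolding equiv_def sym_def by blast

lemma equiv_trans_iff:
  assumes "equiv M R" "(b, c) \<in> R"
  shows "(a, c) \<in> R \<longleftrightarrow> (a, b) \<in> R"
proof -
  have "trans R" "(c, b) \<in> R" using assms by (auto simp: equiv_def sym_def)
  then show ?thesis using assms(2) unfolding trans_def by blast
qed

text \<open>The new point \<open>c\<close> follows some old point \<open>v a0\<close> down to the
  deepest level \<open>l\<close> at which it is equivalent to any old point, and then enters a class
  free of old points. On the other side a free class must be found inside the class of
  \<open>v' a0\<close>; counting provides it.\<close>

lemma same_type_extend:
  fixes v :: "'v \<Rightarrow> 'a" and v' :: "'v \<Rightarrow> 'b"
  assumes M: "splitting_chain M F N \<delta>" and M': "splitting_chain M' F' N \<delta>"
    and S: "finite S" and v: "v ` S \<subseteq> M" and v': "v' ` S \<subseteq> M'"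
    and st: "same_type N F F' S v v'" and c: "c \<in> M"
  shows "\<exists>c'\<in>M'. same_type N F F' (insert x S) (v(x := c)) (v'(x := c'))"
proof -
  \<comment> \<open>The value at \<open>x\<close> is overwritten, so only the other variables
    constrain \<open>c'\<close>.\<close>
  define S0 where "S0 = S - {x}"
  have eq: "equiv M (F m)" "equiv M' (F' m)" if "m \<le> N" for m
    using M M' that unfolding splitting_chain_def by auto
  have st0: "(v a, v b) \<in> F m \<longleftrightarrow> (v' a, v' b) \<in> F' m" if "a \<in> S0" "b \<in> S0" "m \<le> N" for a b m
    using st that unfolding same_type_def S0_def by auto
  have vS: "v a \<in> M" "v' a \<in> M'" if "a \<in> S0" for a
    using v v' that unfolding S0_def by auto
  have "\<exists>c'\<in>M'. \<forall>a\<in>S0. \<forall>m\<le>N. (v a, c) \<in> F m \<longleftrightarrow> (v' a, c') \<in> F' m"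
  proof (cases "S0 = {}")
    case True
    then show ?thesis using M' unfolding splitting_chain_def by auto
  next
    case False
    define L where "L = {m. m \<le> N \<and> (\<exists>a\<in>S0. (v a, c) \<in> F m)}"
    have "0 \<in> L"
      using False M c vS unfolding L_def splitting_chain_def by auto
    then have L: "finite L" "L \<noteq> {}" unfolding L_def by auto
    define l where "l = Max L"
    have lL: "l \<in> L" and lmax: "\<And>m. m \<in> L \<Longrightarrow> m \<le> l"
      unfolding l_def using L by (auto intro: Max_in)
    then obtain a0 where a0: "a0 \<in> S0" "(v a0, c) \<in> F l" and lN: "l \<le> N"
      unfolding L_def by auto
    show ?thesis
    proof (cases "l = N")
      case True
      \<comment> \<open>At the bottom level equivalence is equality, so \<open>c\<close> is an old
        point and its copy is forced.\<close>
      then have "c = v a0" using a0 M unfolding splitting_chain_def by auto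
      then show ?thesis using a0 st0 vS by (intro bexI[of _ "v' a0"]) auto
    next
      case False
      with lN have lN: "l < N" by simp
      define T where "T = {b\<in>S0. (v b, v a0) \<in> F l}"
      define C where "C = F l `` {v a0}"
      define C' where "C' = F' l `` {v' a0}"
      define f where "f b = F (Suc l) `` {v b}" for b
      define f' where "f' b = F' (Suc l) `` {v' b}" for b
      note eql = eq[of l] and eqs = eq[of "Suc l"]
      have T': "T = {b\<in>S0. (v' b, v' a0) \<in> F' l}"
        unfolding T_def using st0 a0 lN by auto
      have fT: "finite T" using S unfolding T_def S0_def by auto
      have ff: "f b = f b' \<longleftrightarrow> f' b = f' b'" if "b \<in> T" "b' \<in> T" for b b'
      proof -
        have "f b = f b' \<longleftrightarrow> (v b, v b') \<in> F (Suc l)"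
          unfolding f_def using that eqs(1) lN vS unfolding T_def
          by (simp add: eq_equiv_class_iff)
        also have "\<dots> \<longleftrightarrow> (v' b, v' b') \<in> F' (Suc l)" using st0 that lN unfolding T_def by auto
        also have "\<dots> \<longleftrightarrow> f' b = f' b'"
          unfolding f'_def using that eqs(2) lN vS unfolding T_def
          by (simp add: eq_equiv_class_iff)
        finally show ?thesis .
      qed
      \<comment> \<open>Equal types make the old points occupy equally many subclasses on both
        sides.\<close>
      have "\<exists>h. bij_betw h (f ` T) (f' ` T)"
      proof (intro exI bij_betwI')
        let ?h = "\<lambda>Q. f' (SOME b. b \<in> T \<and> f b = Q)"
        have h: "?h (f b) = f' b" if "b \<in> T" for b
        proof -
          have "(SOME b'. b' \<in> T \<and> f b' = f b) \<in> T \<and> f (SOME b'. b' \<in> T \<and> f b' = f b) = f b"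
            by (rule someI[of _ b]) (simp add: that)
          then show ?thesis using ff that by blast
        qed
        show "?h A = ?h B \<longleftrightarrow> A = B" if "A \<in> f ` T" "B \<in> f ` T" for A B
        proof -
          obtain b b' where b: "b \<in> T" "A = f b" "b' \<in> T" "B = f b'" using \<open>A \<in> _\<close> \<open>B \<in> _\<close> by blast
          then show ?thesis using h[of b] h[of b'] ff[of b b'] by metis
        qed
        show "?h A \<in> f' ` T" if "A \<in> f ` T" for A using that h by auto
        show "\<exists>A\<in>f ` T. B = ?h A" if "B \<in> f' ` T" for B using that h by auto
      qed
      then have card: "card (f ` T) = card (f' ` T)" using bij_betw_same_card by blast
      have sub: "f ` T \<subseteq> C // F (Suc l)"
        unfolding f_def C_def T_def using eql(1) lN by (auto simp: quotient_def equiv_def sym_def)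
      have sub': "f' ` T \<subseteq> C' // F' (Suc l)"
        unfolding f'_def C'_def T' using eql(2) lN by (auto simp: quotient_def equiv_def sym_def)
      have new: "F (Suc l) `` {c} \<in> C // F (Suc l)"
        using a0(2) by (auto simp: C_def quotient_def)
      have notin: "F (Suc l) `` {c} \<notin> f ` T"
      proof
        assume "F (Suc l) `` {c} \<in> f ` T"
        then obtain b where "b \<in> T" "F (Suc l) `` {v b} = F (Suc l) `` {c}"
          unfolding f_def by auto
        then have "(v b, c) \<in> F (Suc l)" "b \<in> S0"
          using eqs(1) lN c vS by (auto simp: eq_equiv_class_iff T_def)
        then have "Suc l \<in> L" using lN unfolding L_def by auto
        then show False using lmax by fastforce
      qed
      have ecard: "ecard (C // F (Suc l)) = ecard (C' // F' (Suc l))"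
        using M M' lN vS a0(1) unfolding splitting_chain_def C_def C'_def
        by (metis quotientI)
      \<comment> \<open>If the finitely many old points met every subclass of \<open>C'\<close>,
        then \<open>C\<close> would have just as many subclasses, all of them occupied, leaving none
        for \<open>c\<close>.\<close>
      have "f' ` T \<noteq> C' // F' (Suc l)"
      proof
        assume e: "f' ` T = C' // F' (Suc l)"
        then have "finite (C' // F' (Suc l))" using fT by (metis finite_imageI)
        then have "finite (C // F (Suc l))" "card (C // F (Suc l)) = card (f' ` T)"
          using ecard e unfolding ecard_def by (auto split: if_splits)
        then have "f ` T = C // F (Suc l)" using sub card by (metis card_subset_eq)
        then show False using new notin by simp
      qed
      then obtain Q where Q: "Q \<in> C' // F' (Suc l)" "Q \<notin> f' ` T" using sub' by blast
      then obtain c' where c': "c' \<in> C'" "Q = F' (Suc l) `` {c'}" by (auto elim: quotientE)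
      have ac': "(v' a0, c') \<in> F' l" using c'(1) unfolding C'_def by simp
      then have c'M: "c' \<in> M'" using eql(2) lN unfolding equiv_def refl_on_def by auto
      have "(v a, c) \<in> F m \<longleftrightarrow> (v' a, c') \<in> F' m" if a: "a \<in> S0" and m: "m \<le> N" for a m
      proof (cases "m \<le> l")
        case True
        have "(v a0, c) \<in> F m" "(v' a0, c') \<in> F' m"
          using splitting_chain_antimono[OF M True] splitting_chain_antimono[OF M' True] lN a0 ac'
          by auto
        then have "(v a, c) \<in> F m \<longleftrightarrow> (v a, v a0) \<in> F m" "(v' a, c') \<in> F' m \<longleftrightarrow> (v' a, v' a0) \<in> F' m"
          using equiv_trans_iff eq[OF m] by metis+
        then show ?thesis using st0 a a0 m by simp
      next
        case False
        then have "(v a, c) \<notin> F m" using lmax[of m] a m unfolding L_def by auto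
        moreover have "(v' a, c') \<notin> F' m"
        proof
          assume "(v' a, c') \<in> F' m"
          then have s: "(v' a, c') \<in> F' (Suc l)"
            using splitting_chain_antimono[OF M', of "Suc l" m] False m by auto
          then have "(v' a, c') \<in> F' l"
            using splitting_chain_antimono[OF M', of l "Suc l"] lN by auto
          then have "(v' a, v' a0) \<in> F' l"
            using equiv_trans_iff[OF eql(2) ac'] lN by simp
          then have "a \<in> T" using a unfolding T' by simp
          moreover have "f' a = Q" unfolding f'_def c'(2)
            using s eqs(2) lN by (simp add: equiv_class_eq)
          ultimately show False using Q by auto
        qed
        ultimately show ?thesis by simp
      qed
      then show ?thesis using c'M by blast
    qed
  qed
  then obtain c' where c': "c' \<in> M'" "\<And>a m. a \<in> S0 \<Longrightarrow> m \<le> N \<Longrightarrow> (v a, c) \<in> F m \<longleftrightarrow> (v' a, c') \<in> F' m"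
    by blast
  have sym: "(c, v a) \<in> F m \<longleftrightarrow> (c', v' a) \<in> F' m" if "a \<in> S0" "m \<le> N" for a m
    using c'(2)[OF that] eq[OF that(2)] by (metis equiv_commute)
  have refl: "(c, c) \<in> F m" "(c', c') \<in> F' m" if "m \<le> N" for m
    using eq[OF that] c c'(1) unfolding equiv_def refl_on_def by auto
  have "same_type N F F' (insert x S) (v(x := c)) (v'(x := c'))"
    unfolding same_type_def
  proof (intro ballI allI impI)
    fix a b m
    assume ab: "a \<in> insert x S" "b \<in> insert x S" and m: "m \<le> N"
    show "((v(x := c)) a, (v(x := c)) b) \<in> F m \<longleftrightarrow> ((v'(x := c')) a, (v'(x := c')) b) \<in> F' m"
    proof (cases "a = x"; cases "b = x")
    qed (use ab m c' sym refl st0 in \<open>auto simp: S0_def\<close>)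
  qed
  then show ?thesis using c'(1) by blast
qed

lemma same_type_sym: "same_type N F F' S v v' \<Longrightarrow> same_type N F' F S v' v"
  unfolding same_type_def by blast

text \<open>An Ehrenfeucht-Fraisse argument, with \<open>same_type_extend\<close> for the quantifier
  and the bottom level for equality. Atoms are only assumed to respect types, so that two languages
  are served: that of the \<open>E n\<close>, and that of one symbol for the given relation.\<close>

lemma sat_same_type:
  assumes M: "splitting_chain M F N \<delta>" and M': "splitting_chain M' F' N \<delta>"
    and rel: "\<And>r (xs :: nat list) v v'. \<lbrakk>r \<in> L; length xs = ar r; v ` set xs \<subseteq> M; v' ` set xs \<subseteq> M';
        same_type N F F' (set xs) v v'\<rbrakk> \<Longrightarrow> map v xs \<in> D r \<longleftrightarrow> map v' xs \<in> D' r"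
    and "in_language L ar \<phi>" "finite S" "v ` S \<subseteq> M" "v' ` S \<subseteq> M'" "fv \<phi> \<subseteq> S"
    and "same_type N F F' S v v'"
  shows "sat M D v \<phi> \<longleftrightarrow> sat M' D' v' \<phi>"
  using assms(4-)
proof (induction \<phi> arbitrary: S v v')
  case (Eq a b)
  have "(v a, v b) \<in> F N \<longleftrightarrow> (v' a, v' b) \<in> F' N"
    using Eq.prems(5,6) unfolding same_type_def by simp
  moreover have "v a \<in> M" "v' a \<in> M'" using Eq.prems(3,4,5) by auto
  ultimately show ?case
    using splitting_chain_bottom[OF M] splitting_chain_bottom[OF M'] by (simp add: Id_on_iff)
next
  case (Rel r xs)
  have "map v xs \<in> D r \<longleftrightarrow> map v' xs \<in> D' r"
  proof (rule rel)
    show "same_type N F F' (set xs) v v'"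
      using Rel.prems(5,6) unfolding same_type_def by (simp add: subset_iff)
  qed (use Rel.prems in \<open>auto simp: image_subset_iff subset_iff\<close>)
  then show ?case by simp
next
  case (Neg \<phi>)
  have "sat M D v \<phi> = sat M' D' v' \<phi>" by (rule Neg.IH[of S]) (use Neg.prems in auto)
  then show ?case by simp
next
  case (Conj \<phi> \<psi>)
  have "sat M D v \<phi> = sat M' D' v' \<phi>" by (rule Conj.IH(1)[of S]) (use Conj.prems in auto)
  moreover have "sat M D v \<psi> = sat M' D' v' \<psi>" by (rule Conj.IH(2)[of S]) (use Conj.prems in auto)
  ultimately show ?case by simp
next
  case (Ex x \<phi>)
  have IH: "sat M D (v(x := c)) \<phi> = sat M' D' (v'(x := c')) \<phi>"
    if "c \<in> M" "c' \<in> M'" "same_type N F F' (insert x S) (v(x := c)) (v'(x := c'))" for c c'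
    by (rule Ex.IH[OF _ _ _ _ _ that(3)]) (use Ex.prems(1-5) that(1,2) in auto)
  show ?case
  proof
    assume "sat M D v (Ex x \<phi>)"
    then obtain c where c: "c \<in> M" "sat M D (v(x := c)) \<phi>" by auto
    obtain c' where c': "c' \<in> M'" "same_type N F F' (insert x S) (v(x := c)) (v'(x := c'))"
      using same_type_extend[OF M M' Ex.prems(2,3,4) Ex.prems(6) c(1)] by blast
    have "sat M' D' (v'(x := c')) \<phi>" using IH[OF c(1) c'] c(2) by simp
    then show "sat M' D' v' (Ex x \<phi>)" using c'(1) by auto
  next
    assume "sat M' D' v' (Ex x \<phi>)"
    then obtain c' where c': "c' \<in> M'" "sat M' D' (v'(x := c')) \<phi>" by auto
    obtain c where c: "c \<in> M" "same_type N F' F (insert x S) (v'(x := c')) (v(x := c))"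
      using same_type_extend[OF M' M Ex.prems(2,4,3) same_type_sym[OF Ex.prems(6)] c'(1)] by blast
    have "sat M D (v(x := c)) \<phi>" using IH[OF c(1) c'(1) same_type_sym[OF c(2)]] c'(2) by simp
    then show "sat M D v (Ex x \<phi>)" using c(1) by auto
  qed
qed

lemma same_type_copy:
  assumes M: "splitting_chain M F N \<delta>" and M': "splitting_chain M' F' N \<delta>"
    and "finite S" "v ` S \<subseteq> M"
  shows "\<exists>v'. (\<forall>i. v' i \<in> M') \<and> same_type N F F' S v v'"
  using assms(3,4)
proof (induction S rule: finite_induct)
  case empty
  obtain c where "c \<in> M'" using M' unfolding splitting_chain_def by blast
  then show ?case by (intro exI[of _ "\<lambda>_. c"]) (simp add: same_type_def)
next
  case (insert x S)
  then obtain v' where v': "\<forall>i. v' i \<in> M'" "same_type N F F' S v v'" by auto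
  then obtain c' where "c' \<in> M'" "same_type N F F' (insert x S) (v(x := v x)) (v'(x := c'))"
    using same_type_extend[OF M M' insert.hyps(1) _ _ v'(2), of "v x" x] insert.prems by blast
  then show ?case using v'(1) by (intro exI[of _ "v'(x := c')"]) (simp del: fun_upd_apply, simp)
qed

section \<open>The tree of sequences\<close>

definition agree :: "nat \<Rightarrow> (nat \<Rightarrow> nat) \<Rightarrow> (nat \<Rightarrow> nat) \<Rightarrow> bool" where
  "agree m s t \<longleftrightarrow> (\<forall>i<m. s i = t i)"

text \<open>Sequences of length \<open>N\<close>, padded with zeros so that agreement up to
  \<open>N\<close> is equality. An infinite \<open>\<delta> m\<close> allows every natural number as
  label.\<close>

definition tree :: "nat \<Rightarrow> (nat \<Rightarrow> enat) \<Rightarrow> (nat \<Rightarrow> nat) set" where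
  "tree N \<delta> = {s. (\<forall>m<N. enat (s m) < \<delta> m) \<and> (\<forall>m\<ge>N. s m = 0)}"

definition tree_rel :: "nat \<Rightarrow> (nat \<Rightarrow> enat) \<Rightarrow> nat \<Rightarrow> ((nat \<Rightarrow> nat) \<times> (nat \<Rightarrow> nat)) set" where
  "tree_rel N \<delta> m = {(s, t). s \<in> tree N \<delta> \<and> t \<in> tree N \<delta> \<and> agree m s t}"

lemma agree_refl [simp]: "agree m s s"
  by (simp add: agree_def)

lemma agree_zero [simp]: "agree 0 s t"
  by (simp add: agree_def)

lemma agree_sym: "agree m s t \<longleftrightarrow> agree m t s"
  unfolding agree_def by metis

lemma agree_trans: "agree m s t \<Longrightarrow> agree m t u \<Longrightarrow> agree m s u"
  unfolding agree_def by metis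

lemma agree_trans': "agree m s t \<Longrightarrow> agree m s u \<Longrightarrow> agree m t u"
  unfolding agree_def by metis

lemma agree_mono: "agree m s t \<Longrightarrow> l \<le> m \<Longrightarrow> agree l s t"
  unfolding agree_def by (meson order_less_le_trans)

lemma agree_cong: "agree m s s' \<Longrightarrow> agree m t t' \<Longrightarrow> agree m s t \<longleftrightarrow> agree m s' t'"
  unfolding agree_def by metis

lemma agree_eq: "s \<in> tree N \<delta> \<Longrightarrow> t \<in> tree N \<delta> \<Longrightarrow> agree N s t \<longleftrightarrow> s = t"
  by (auto simp: agree_def tree_def fun_eq_iff) (metis not_le)

lemma ecard_bij_betw: "bij_betw h A B \<Longrightarrow> ecard A = ecard B"
  by (simp add: ecard_def bij_betw_finite bij_betw_same_card)

lemma ecard_below: "ecard {v. enat v < d} = d"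
proof (cases d)
  case (enat n)
  then have "{v. enat v < d} = {..<n}" by auto
  then show ?thesis by (simp add: ecard_def enat)
next
  case infinity
  then show ?thesis by (simp add: ecard_def)
qed

lemma splitting_chain_tree:
  assumes \<delta>: "\<And>m. m < N \<Longrightarrow> 1 \<le> \<delta> m"
  shows "splitting_chain (tree N \<delta>) (tree_rel N \<delta>) N \<delta>"
proof -
  let ?T = "tree N \<delta>" and ?F = "tree_rel N \<delta>"
  \<comment> \<open>The label 0 is allowed at every height, so the zero sequence shows that the tree
    is not empty.\<close>
  have "enat 0 < \<delta> m" if "m < N" for m
    using \<delta>[OF that] by (metis i0_less not_one_le_zero zero_enat_def)
  then have ne: "(\<lambda>_. 0) \<in> ?T" by (simp add: tree_def)
  have eq: "equiv ?T (?F m)" for m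
  proof (rule equivI)
    show "?F m \<subseteq> ?T \<times> ?T" by (auto simp: tree_rel_def)
    show "refl_on ?T (?F m)" by (auto simp: refl_on_def tree_rel_def)
    show "sym (?F m)" by (auto simp: sym_def tree_rel_def agree_sym)
    show "trans (?F m)" by (auto simp: trans_def tree_rel_def intro: agree_trans)
  qed
  have "ecard (C // ?F (Suc m)) = \<delta> m" if C: "C \<in> ?T // ?F m" and m: "m < N" for C m
  proof -
    obtain s where s: "s \<in> ?T" "C = ?F m `` {s}" using C by (auto elim: quotientE)
    \<comment> \<open>The subclasses of the class of \<open>s\<close> correspond to the possible
      labels in position \<open>m\<close>.\<close>
    let ?h = "\<lambda>v. ?F (Suc m) `` {s(m := v)}"
    have sT: "s(m := v) \<in> ?T" if "enat v < \<delta> m" for v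
      using s(1) m that by (auto simp: tree_def)
    have "bij_betw ?h {v. enat v < \<delta> m} (C // ?F (Suc m))"
    proof (rule bij_betwI')
      fix v w
      assume "v \<in> {v. enat v < \<delta> m}" "w \<in> {v. enat v < \<delta> m}"
      then have "s(m := v) \<in> ?T" "s(m := w) \<in> ?T" using sT by auto
      then have "?h v = ?h w \<longleftrightarrow> agree (Suc m) (s(m := v)) (s(m := w))"
        using eq_equiv_class_iff[OF eq] by (simp add: tree_rel_def)
      then show "?h v = ?h w \<longleftrightarrow> v = w" by (auto simp: agree_def)
    next
      fix v
      assume "v \<in> {v. enat v < \<delta> m}"
      then have "s(m := v) \<in> C" using sT s by (auto simp: tree_rel_def agree_def)
      then show "?h v \<in> C // ?F (Suc m)" by (rule quotientI)
    next
      fix Q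
      assume "Q \<in> C // ?F (Suc m)"
      then obtain t where t: "t \<in> C" "Q = ?F (Suc m) `` {t}" by (auto elim: quotientE)
      then have tT: "t \<in> ?T" and ag: "agree m s t" using s(2) by (auto simp: tree_rel_def)
      have tm: "enat (t m) < \<delta> m" using tT m by (simp add: tree_def)
      have "agree (Suc m) t (s(m := t m))" using ag by (auto simp: agree_def less_Suc_eq)
      then have "(t, s(m := t m)) \<in> ?F (Suc m)" using tT sT[OF tm] by (simp add: tree_rel_def)
      then have "Q = ?h (t m)" unfolding t(2) by (rule equiv_class_eq[OF eq])
      then show "\<exists>v\<in>{v. enat v < \<delta> m}. Q = ?h v" using tm by blast
    qed
    from ecard_bij_betw[OF this] show ?thesis by (simp add: ecard_below)
  qed
  moreover have "?F N = Id_on ?T" by (auto simp: tree_rel_def agree_eq)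
  moreover have "?F 0 = ?T \<times> ?T" by (auto simp: tree_rel_def)
  moreover have "?F (Suc m) \<subseteq> ?F m" for m by (auto simp: tree_rel_def agree_def)
  ultimately show ?thesis using eq ne unfolding splitting_chain_def by blast
qed

section \<open>Swaps of subtrees\<close>

definition graft :: "nat \<Rightarrow> (nat \<Rightarrow> nat) \<Rightarrow> (nat \<Rightarrow> nat) \<Rightarrow> nat \<Rightarrow> nat" where
  "graft j x s = (\<lambda>i. if i < j then x i else s i)"

text \<open>The involution exchanging the subtrees of the nodes of height \<open>j\<close> below \<open>x\<close> and \<open>y\<close>.\<close>

definition swap :: "nat \<Rightarrow> (nat \<Rightarrow> nat) \<Rightarrow> (nat \<Rightarrow> nat) \<Rightarrow> (nat \<Rightarrow> nat) \<Rightarrow> nat \<Rightarrow> nat" where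
  "swap j x y s = (if agree j s x then graft j y s else if agree j s y then graft j x s else s)"

text \<open>Splitting numbers depend on the height only, so the tail of any sequence fits below any
  node.\<close>

lemma graft_in_tree: "x \<in> tree N \<delta> \<Longrightarrow> s \<in> tree N \<delta> \<Longrightarrow> graft j x s \<in> tree N \<delta>"
  by (auto simp: graft_def tree_def)

lemma agree_graft [simp]: "agree j (graft j x s) t \<longleftrightarrow> agree j x t"
  by (auto simp: graft_def agree_def)

lemma graft_graft [simp]: "graft j x (graft j y s) = graft j x s"
  by (auto simp: graft_def)

lemma graft_id: "agree j s x \<Longrightarrow> graft j x s = s"
  by (auto simp: graft_def agree_def)

lemma swap_in_tree:
  "x \<in> tree N \<delta> \<Longrightarrow> y \<in> tree N \<delta> \<Longrightarrow> s \<in> tree N \<delta> \<Longrightarrow> swap j x y s \<in> tree N \<delta>"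
  by (auto simp: swap_def graft_in_tree)

lemma swap_left: "agree j s x \<Longrightarrow> swap j x y s = graft j y s"
  by (simp add: swap_def)

lemma swap_right: "agree j s y \<Longrightarrow> swap j x y s = graft j x s"
  by (simp add: swap_def graft_id)

lemma swap_other: "\<not> agree j s x \<Longrightarrow> \<not> agree j s y \<Longrightarrow> swap j x y s = s"
  by (simp add: swap_def)

lemma swap_trivial:
  assumes "agree j x y"
  shows "swap j x y s = s"
proof -
  have "agree j s x \<longleftrightarrow> agree j s y" using agree_cong[OF agree_refl assms] .
  then show ?thesis by (simp add: swap_def graft_id)
qed

lemma swap_swap [simp]: "swap j x y (swap j x y s) = s"
proof -
  consider "agree j s x" | "agree j s y" | "\<not> agree j s x" "\<not> agree j s y" by blast
  then show ?thesis
    by cases (simp_all add: swap_left swap_right swap_other graft_id)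
qed

text \<open>The identity \<open>(x w) = (x y)(y w)(x y)\<close> for transpositions of three
  different nodes.\<close>

lemma swap_conj:
  assumes "\<not> agree j x y" "\<not> agree j y w" "\<not> agree j x w"
  shows "swap j x w s = swap j x y (swap j y w (swap j x y s))"
proof -
  have sym: "\<not> agree j y x" "\<not> agree j w y" "\<not> agree j w x"
    using assms by (simp_all add: agree_sym[of j y x] agree_sym[of j w])
  consider "agree j s x" | "agree j s y" | "agree j s w"
    | "\<not> agree j s x" "\<not> agree j s y" "\<not> agree j s w" by blast
  then show ?thesis
  proof cases
    case 1
    then show ?thesis using assms sym by (simp add: swap_left swap_other)
  next
    case 2
    then have "\<not> agree j s x" "\<not> agree j s w" using assms sym agree_trans' by blast+
    with 2 show ?thesis using assms sym by (simp add: swap_right swap_other swap_left graft_id)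
  next
    case 3
    then have "\<not> agree j s x" "\<not> agree j s y" using assms sym agree_trans' by blast+
    with 3 show ?thesis using assms sym by (simp add: swap_right swap_other)
  next
    case 4
    then show ?thesis by (simp add: swap_other)
  qed
qed

lemma agree_swap_iff:
  "agree j (swap j x y s) t \<longleftrightarrow>
     (if agree j s x then agree j y t else if agree j s y then agree j x t else agree j s t)"
  by (simp add: swap_def)

lemma swap_close: "agree m x y \<Longrightarrow> m \<le> j \<Longrightarrow> agree m (swap j x y s) s"
  by (auto simp: swap_def graft_def agree_def)

lemma swap_preserves_above:
  assumes "j \<le> m" "agree m s t"
  shows "agree m (swap j x y s) (swap j x y t)"
proof -
  have "agree j s t" using assms agree_mono by blast
  then have "agree j s z \<longleftrightarrow> agree j t z" for z by (rule agree_cong) simp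
  then show ?thesis using assms unfolding swap_def by (auto simp: graft_def agree_def)
qed

text \<open>Two sequences that agree up to some \<open>m \<ge> j\<close> pass through the same node
  of height \<open>j\<close> and move together; the converse holds because a swap is an involution.
  For \<open>m < j\<close> every point stays in its class as soon as \<open>x\<close> and
  \<open>y\<close> agree up to \<open>m\<close>.\<close>

lemma swap_preserves:
  assumes "m < j \<Longrightarrow> agree m x y"
  shows "agree m (swap j x y s) (swap j x y t) \<longleftrightarrow> agree m s t"
proof (cases "m < j")
  case True
  then show ?thesis using assms by (intro agree_cong swap_close) auto
next
  case False
  then have "j \<le> m" by simp
  from swap_preserves_above[OF this, of s t x y]
    swap_preserves_above[OF this, of "swap j x y s" "swap j x y t" x y]
  show ?thesis by auto
qed

section \<open>Types of tuples and homogeneity of the tree\<close>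

definition same_types :: "nat set \<Rightarrow> (nat \<Rightarrow> nat) list \<Rightarrow> (nat \<Rightarrow> nat) list \<Rightarrow> bool" where
  "same_types K xs ys \<longleftrightarrow> length xs = length ys \<and>
     (\<forall>a<length xs. \<forall>b<length xs. \<forall>m\<in>K. agree m (xs ! a) (xs ! b) \<longleftrightarrow> agree m (ys ! a) (ys ! b))"

lemma same_types_sym: "same_types K xs ys \<Longrightarrow> same_types K ys xs"
  unfolding same_types_def by metis

lemma same_types_trans: "same_types K xs ys \<Longrightarrow> same_types K ys zs \<Longrightarrow> same_types K xs zs"
  unfolding same_types_def by metis

lemma same_types_swap:
  assumes "\<And>m. m \<in> K \<Longrightarrow> m < j \<Longrightarrow> agree m x y"
  shows "same_types K (map (swap j x y) zs) zs"
  unfolding same_types_def using assms by (simp add: swap_preserves)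

text \<open>Below \<open>j\<close>, entrywise agreement settles the type. So tuples can be compared
  knowing only the nodes of height \<open>j\<close> and the types from \<open>j\<close> on.\<close>

lemma same_types_if_close:
  assumes "same_types (K \<inter> {j..}) xs ys" "\<And>a. a < length xs \<Longrightarrow> agree j (xs ! a) (ys ! a)"
  shows "same_types K xs ys"
  unfolding same_types_def
proof (intro conjI allI impI ballI)
  show "length xs = length ys" using assms(1) by (simp add: same_types_def)
  fix a b m
  assume ab: "a < length xs" "b < length xs" and m: "m \<in> K"
  show "agree m (xs ! a) (xs ! b) \<longleftrightarrow> agree m (ys ! a) (ys ! b)"
  proof (cases "j \<le> m")
    case True
    then show ?thesis using assms(1) ab m by (auto simp: same_types_def)
  next
    case False
    then have "agree m (xs ! a) (ys ! a)" "agree m (xs ! b) (ys ! b)"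
      using assms(2) ab agree_mono by (metis nat_le_linear)+
    then show ?thesis by (rule agree_cong)
  qed
qed

lemma swap_map_tuples:
  "x \<in> tree N \<delta> \<Longrightarrow> y \<in> tree N \<delta> \<Longrightarrow> zs \<in> tuples (tree N \<delta>) k \<Longrightarrow>
    map (swap j x y) zs \<in> tuples (tree N \<delta>) k"
  unfolding tuples_def by (auto intro: swap_in_tree)

text \<open>The tuple \<open>zs\<close> is moved to \<open>ws\<close> entry by entry, and each entry level by level: once
  an entry agrees with its target below \<open>i\<close>, a swap of height \<open>i\<close> improves the agreement, and
  equality of types guarantees that the entries already in place are fixed.\<close>

lemma homogeneous:
  assumes "N \<in> K"
    and inv: "\<And>j x y zs. \<lbrakk>j \<in> K; x \<in> tree N \<delta>; y \<in> tree N \<delta>; \<And>m. m \<in> K \<Longrightarrow> m < j \<Longrightarrow> agree m x y;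
        zs \<in> tuples (tree N \<delta>) k; zs \<in> X\<rbrakk> \<Longrightarrow> map (swap j x y) zs \<in> X"
    and zs: "zs \<in> tuples (tree N \<delta>) k" "zs \<in> X" and ws: "ws \<in> tuples (tree N \<delta>) k"
    and st: "same_types K zs ws"
  shows "ws \<in> X"
proof -
  let ?T = "tree N \<delta>"
  define G where "G l us \<longleftrightarrow> us \<in> tuples ?T k \<and> us \<in> X \<and> same_types K us ws \<and>
      (\<forall>a<l. us ! a = ws ! a)" for l us
  have step: "\<exists>us. G l us \<and> (\<forall>m\<in>K. m < i \<longrightarrow> agree m (us ! l) (ws ! l))"
    if "\<exists>us. G l us" and l: "l < k" for l i
  proof (induction i)
    case 0
    then show ?case using that by simp
  next
    case (Suc i)
    then obtain us where us: "G l us" "\<And>m. m \<in> K \<Longrightarrow> m < i \<Longrightarrow> agree m (us ! l) (ws ! l)" by blast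
    show ?case
    proof (cases "i \<in> K")
      case False
      then show ?thesis using us by (intro exI[of _ us]) (auto simp: less_Suc_eq)
    next
      case True
      define vs where "vs = map (swap i (us ! l) (ws ! l)) us"
      have len: "length us = k" "length ws = k" using us(1) ws by (auto simp: G_def tuples_def)
      have T: "us ! l \<in> ?T" "ws ! l \<in> ?T"
        using us(1) ws l by (auto simp: G_def tuples_def)
      have "vs \<in> X" unfolding vs_def using us True T by (intro inv) (auto simp: G_def)
      moreover have "vs \<in> tuples ?T k" unfolding vs_def using T us(1)
        by (intro swap_map_tuples) (auto simp: G_def)
      moreover have "same_types K vs ws"
        using same_types_trans[OF same_types_swap[of K i "us ! l" "ws ! l" us]] us
        unfolding vs_def G_def by blast
      moreover have "vs ! a = ws ! a" if a: "a < l" for a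
      proof -
        have e: "us ! a = ws ! a" using us(1) a by (simp add: G_def)
        have "agree i (us ! a) (us ! l) \<longleftrightarrow> agree i (ws ! a) (ws ! l)"
        proof -
          have "same_types K us ws" "a < k" using us(1) a l by (simp_all add: G_def)
          then show ?thesis using True l len(1) by (simp add: same_types_def)
        qed
        then have "swap i (us ! l) (ws ! l) (us ! a) = us ! a"
          using e by (metis graft_id swap_def)
        then show ?thesis using a l len e by (simp add: vs_def)
      qed
      ultimately have "G l vs" by (simp add: G_def)
      moreover have "agree m (vs ! l) (ws ! l)" if "m \<in> K" "m < Suc i" for m
      proof -
        have "agree i (vs ! l) (ws ! l)" using l len by (simp add: vs_def agree_swap_iff)
        then show ?thesis using that agree_mono by (metis less_Suc_eq_le)
      qed
      ultimately show ?thesis by blast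
    qed
  qed
  have "\<exists>us. G l us" if "l \<le> k" for l
    using that
  proof (induction l)
    case 0
    then show ?case using zs st by (auto simp: G_def)
  next
    case (Suc l)
    \<comment> \<open>The bound in \<open>step\<close> is strict: \<open>Suc N\<close> includes the
      height \<open>N \<in> K\<close>, where agreement is equality.\<close>
    then obtain us where us: "G l us" "\<forall>m\<in>K. m < Suc N \<longrightarrow> agree m (us ! l) (ws ! l)"
      using step[of l "Suc N"] by auto
    have "us ! l \<in> ?T" "ws ! l \<in> ?T"
      using us(1) ws Suc.prems by (auto simp: G_def tuples_def)
    then have "us ! l = ws ! l" using us(2) assms(1) agree_eq by blast
    then show ?case using us(1) by (auto simp: G_def less_Suc_eq)
  qed
  then obtain us where us: "G k us" by blast
  then have "us = ws" using ws by (intro nth_equalityI) (auto simp: G_def tuples_def)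
  then show ?thesis using us by (simp add: G_def)
qed

section \<open>Swaps that preserve a relation invariant under types\<close>

lemma agree_iff_le: "agree l x y \<Longrightarrow> x l \<noteq> y l \<Longrightarrow> agree m x y \<longleftrightarrow> m \<le> l"
  by (cases "m \<le> l") (auto simp: agree_def not_le)

text \<open>Stands in for definability in the combinatorial argument. One implication suffices
  because equality of types is symmetric.\<close>

locale invariant_relation =
  fixes N :: nat and \<delta> :: "nat \<Rightarrow> enat" and k :: nat and X :: "(nat \<Rightarrow> nat) list set"
  assumes invariant: "\<lbrakk>zs \<in> tuples (tree N \<delta>) k; ws \<in> tuples (tree N \<delta>) k; same_types {..N} zs ws;
    zs \<in> X\<rbrakk> \<Longrightarrow> ws \<in> X"
begin

abbreviation T where "T \<equiv> tree N \<delta>"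

text \<open>One inclusion is enough, since a swap is its own inverse.\<close>

definition swappable :: "nat \<Rightarrow> (nat \<Rightarrow> nat) \<Rightarrow> (nat \<Rightarrow> nat) \<Rightarrow> bool" where
  "swappable j x y \<longleftrightarrow> (\<forall>zs \<in> tuples T k. zs \<in> X \<longrightarrow> map (swap j x y) zs \<in> X)"

lemma swappable_if_agree: "agree j x y \<Longrightarrow> swappable j x y"
  by (simp add: swappable_def swap_trivial map_idI)

text \<open>For three different nodes \<open>swap_conj\<close> writes the third swap as a product of
  the given ones. When two nodes coincide the claim is immediate, as a swap depends on the nodes
  only.\<close>

lemma swappable_trans:
  assumes xy: "swappable j x y" and yw: "swappable j y w" and T: "x \<in> T" "y \<in> T" "w \<in> T"
  shows "swappable j x w"
proof -
  have cong: "swap j a b = swap j a' b'" if "agree j a a'" "agree j b b'" for a a' b b'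
  proof
    fix s
    have "agree j s a \<longleftrightarrow> agree j s a'" "agree j s b \<longleftrightarrow> agree j s b'"
      using agree_cong[OF agree_refl that(1)] agree_cong[OF agree_refl that(2)] by blast+
    moreover have "graft j a s = graft j a' s" "graft j b s = graft j b' s"
      using that by (auto simp: graft_def agree_def)
    ultimately show "swap j a b s = swap j a' b' s" by (simp add: swap_def)
  qed
  consider "agree j x y" | "agree j y w" | "agree j x w"
    | "\<not> agree j x y" "\<not> agree j y w" "\<not> agree j x w" by blast
  then show ?thesis
  proof cases
    case 1
    then show ?thesis using yw cong[of x y w w] by (simp add: swappable_def)
  next
    case 2
    then show ?thesis using xy cong[of x x y w] by (simp add: swappable_def)
  next
    case 3
    then show ?thesis by (rule swappable_if_agree)
  next
    case 4
    show ?thesis unfolding swappable_def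
    proof (intro ballI impI)
      fix zs assume zs: "zs \<in> tuples T k" "zs \<in> X"
      let ?u = "map (swap j x y) zs"
      let ?v = "map (swap j y w) ?u"
      have u: "?u \<in> tuples T k" "?u \<in> X"
        using zs xy T by (auto simp: swappable_def intro: swap_map_tuples)
      then have v: "?v \<in> tuples T k" "?v \<in> X"
        using yw T unfolding swappable_def by (blast intro: swap_map_tuples)+
      have eq: "map (swap j x w) zs = map (swap j x y) ?v"
        by (simp add: swap_conj[OF 4])
      show "map (swap j x w) zs \<in> X" unfolding eq using xy v unfolding swappable_def by blast
    qed
  qed
qed

text \<open>The exchanged nodes have a common parent, so no height is disturbed: the swap is an
  automorphism of the whole chain and preserves full types.\<close>

lemma swappable_if_siblings:
  assumes "x \<in> T" "y \<in> T" "\<And>m. m < j \<Longrightarrow> agree m x y"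
  shows "swappable j x y"
  unfolding swappable_def
proof (intro ballI impI)
  fix zs assume zs: "zs \<in> tuples T k" "zs \<in> X"
  have "same_types {..N} zs (map (swap j x y) zs)"
    using assms(3) by (intro same_types_sym[OF same_types_swap]) auto
  from invariant[OF zs(1) swap_map_tuples[OF assms(1,2) zs(1)] this zs(2)]
  show "map (swap j x y) zs \<in> X" .
qed

text \<open>Conjugation by the automorphism \<open>g = swap i p q\<close> carries the swap of
  \<open>x\<close> and \<open>y\<close> to that of their images, as far as \<open>X\<close> can
  tell.\<close>

lemma swappable_image:
  assumes xy: "x \<in> T" "y \<in> T" "swappable j x y"
    and pq: "p \<in> T" "q \<in> T" "\<And>m. m < i \<Longrightarrow> agree m p q"
  shows "swappable j (swap i p q x) (swap i p q y)"
proof -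
  define g where "g = swap i p q"
  have gm: "agree m (g s) (g t) \<longleftrightarrow> agree m s t" for m s t
    unfolding g_def using pq(3) by (rule swap_preserves)
  have gT: "g s \<in> T" if "s \<in> T" for s
    unfolding g_def using pq(1,2) that by (rule swap_in_tree)
  have gX: "map g us \<in> X" if "us \<in> tuples T k" "us \<in> X" for us
    using swappable_if_siblings[OF pq] that unfolding swappable_def g_def by blast
  have gt: "map g us \<in> tuples T k" if "us \<in> tuples T k" for us
    unfolding g_def using pq(1,2) that by (rule swap_map_tuples)
  have "swappable j (g x) (g y)"
    unfolding swappable_def
  proof (intro ballI impI)
    fix zs assume zs: "zs \<in> tuples T k" "zs \<in> X"
    let ?z1 = "map g zs"
    let ?z2 = "map (swap j x y) ?z1"
    let ?z3 = "map g ?z2"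
    let ?ws = "map (swap j (g x) (g y)) zs"
    have z1: "?z1 \<in> tuples T k" "?z1 \<in> X" using zs gX gt by blast+
    then have z2: "?z2 \<in> tuples T k" "?z2 \<in> X"
      using xy(3) swap_map_tuples[OF xy(1,2)] unfolding swappable_def by blast+
    then have z3: "?z3 \<in> tuples T k" "?z3 \<in> X" using gX gt by blast+
    have ws: "?ws \<in> tuples T k"
      using zs(1) xy(1,2) by (intro swap_map_tuples gT)
    \<comment> \<open>The conjugate need not equal the swap of the images: for \<open>i > j\<close>,
      \<open>g\<close> may alter tails inside only one of the two subtrees. Still both results pass
      through the same nodes of height \<open>j\<close> and have equal types from \<open>j\<close>
      on.\<close>
    have "same_types {..N} ?z3 ?ws"
    proof (rule same_types_if_close)
      show "same_types ({..N} \<inter> {j..}) ?z3 ?ws"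
        unfolding same_types_def by (auto simp: gm swap_preserves)
      fix a assume "a < length ?z3"
      then have a: "a < length zs" by simp
      have gg: "g (g s) = s" for s by (simp add: g_def)
      then obtain z where z: "zs ! a = g z" by metis
      have "agree j t (graft j u s) \<longleftrightarrow> agree j t u" for t u s
        by (auto simp: graft_def agree_def)
      then have "agree j (g (swap j x y z)) (swap j (g x) (g y) (g z))"
        by (simp add: swap_def gm)
      then show "agree j (?z3 ! a) (?ws ! a)" using a by (simp add: z gg)
    qed
    from invariant[OF z3(1) ws this z3(2)] show "?ws \<in> X" .
  qed
  then show ?thesis by (simp only: g_def)
qed

text \<open>The map \<open>f\<close> of the overview; the minimum exists because \<open>j\<close>
  itself qualifies. That agreement at this height is also necessary for being swappable is
  \<open>agree_lift_if_swappable\<close>.\<close>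

definition lift_level :: "nat \<Rightarrow> nat" where
  "lift_level j = (LEAST m. \<forall>x\<in>T. \<forall>y\<in>T. agree m x y \<longrightarrow> swappable j x y)"

lemma swappable_if_agree_lift:
  "x \<in> T \<Longrightarrow> y \<in> T \<Longrightarrow> agree (lift_level j) x y \<Longrightarrow> swappable j x y"
  unfolding lift_level_def
  using LeastI[of "\<lambda>m. \<forall>x\<in>T. \<forall>y\<in>T. agree m x y \<longrightarrow> swappable j x y" j] swappable_if_agree by blast

lemma lift_level_least:
  "(\<And>x y. x \<in> T \<Longrightarrow> y \<in> T \<Longrightarrow> agree m x y \<Longrightarrow> swappable j x y) \<Longrightarrow> lift_level j \<le> m"
  unfolding lift_level_def by (rule Least_le) blast

lemma lift_level_le: "lift_level j \<le> j"
  by (rule lift_level_least) (rule swappable_if_agree)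

text \<open>Siblings can always be swapped, hence a drop by at least one; so the iteration descends
  strictly until it reaches 0.\<close>

lemma lift_level_less:
  assumes "0 < j"
  shows "lift_level j < j"
proof -
  have "lift_level j \<le> j - 1"
  proof (rule lift_level_least)
    fix x y assume "x \<in> T" "y \<in> T" "agree (j - 1) x y"
    then show "swappable j x y"
      using agree_mono[of "j - 1" x y] by (intro swappable_if_siblings) auto
  qed
  then show ?thesis using assms by simp
qed

text \<open>Being swappable is invariant under swaps of siblings, so by homogeneity one swappable pair
  separating at height \<open>l\<close> makes all such pairs swappable.\<close>

lemma swappable_at_level:
  assumes xy: "x \<in> T" "y \<in> T" "agree l x y" "x l \<noteq> y l" "swappable j x y"
    and uw: "u \<in> T" "w \<in> T" "agree l u w" "u l \<noteq> w l"
  shows "swappable j u w"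
proof -
  have "[u, w] \<in> {[x, y] | x y. x \<in> T \<and> y \<in> T \<and> swappable j x y}"
  proof (rule homogeneous[of N "{..N}" \<delta> 2 _ "[x, y]"])
    have iff: "agree m x y \<longleftrightarrow> m \<le> l" "agree m u w \<longleftrightarrow> m \<le> l" for m
      using agree_iff_le xy(3,4) uw(3,4) by blast+
    then have "agree m y x \<longleftrightarrow> m \<le> l" "agree m w u \<longleftrightarrow> m \<le> l" for m
      using agree_sym by blast+
    with iff show "same_types {..N} [x, y] [u, w]"
      by (simp add: same_types_def less_Suc_eq all_conj_distrib imp_conjL)
  next
    fix i p q zs
    assume pq: "p \<in> T" "q \<in> T" "\<And>m. m \<in> {..N} \<Longrightarrow> m < i \<Longrightarrow> agree m p q" and i: "i \<in> {..N}"
      and "zs \<in> {[x, y] | x y. x \<in> T \<and> y \<in> T \<and> swappable j x y}"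
    then obtain a b where ab: "zs = [a, b]" "a \<in> T" "b \<in> T" "swappable j a b" by blast
    have "swappable j (swap i p q a) (swap i p q b)"
      using ab pq i by (intro swappable_image) auto
    then show "map (swap i p q) zs \<in> {[x, y] | x y. x \<in> T \<and> y \<in> T \<and> swappable j x y}"
      using ab pq by (auto intro: swap_in_tree)
  qed (use xy uw in \<open>auto simp: tuples_def\<close>)
  then show ?thesis by simp
qed

text \<open>If \<open>x\<close> and \<open>y\<close> separate at some \<open>l\<close> below
  \<open>lift_level j\<close>, then all pairs separating at \<open>l\<close> are swappable, and by
  transitivity so are all pairs agreeing up to \<open>l\<close>, against the minimality of
  \<open>lift_level j\<close>.\<close>

lemma agree_lift_if_swappable:
  assumes xy: "x \<in> T" "y \<in> T" "swappable j x y" and j: "j \<le> N"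
  shows "agree (lift_level j) x y"
proof (rule ccontr)
  assume "\<not> agree (lift_level j) x y"
  then have ex: "\<exists>i. i < lift_level j \<and> x i \<noteq> y i" unfolding agree_def by blast
  then obtain l where l: "l < lift_level j" "x l \<noteq> y l"
    and least: "\<And>i. i < l \<Longrightarrow> \<not> (i < lift_level j \<and> x i \<noteq> y i)"
    using exists_least_iff[of "\<lambda>i. i < lift_level j \<and> x i \<noteq> y i"] by blast
  have ag: "agree l x y" unfolding agree_def using least l(1) by auto
  have lN: "l < N" using l(1) lift_level_le[of j] j by simp
  have "lift_level j \<le> l"
  proof (rule lift_level_least)
    fix u w assume uw: "u \<in> T" "w \<in> T" "agree l u w"
    note level = swappable_at_level[OF xy(1,2) ag l(2) xy(3)]
    show "swappable j u w"
    proof (cases "u l = w l")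
      case False
      then show ?thesis using uw level by blast
    next
      case True
      \<comment> \<open>A detour for pairs that do not separate at \<open>l\<close>: of the two
        different labels \<open>x l\<close> and \<open>y l\<close> one is not \<open>u l\<close>,
        and both are legal at height \<open>l\<close>.\<close>
      define c where "c = (if x l = u l then y l else x l)"
      have c: "c \<noteq> u l" "c \<noteq> w l" using l(2) True by (auto simp: c_def)
      have v: "u(l := c) \<in> T" using uw(1) xy(1,2) lN by (auto simp: c_def tree_def)
      have "agree l u (u(l := c))" "agree l (u(l := c)) w"
        using uw(3) by (auto simp: agree_def)
      then have "swappable j u (u(l := c))" "swappable j (u(l := c)) w"
        using uw v c by (auto intro!: level)
      then show ?thesis using swappable_trans uw v by blast
    qed
  qed
  then show False using l(1) by simp
qed

section \<open>The heights that the relation sees, and their definability from it\<close>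

definition levels :: "nat set" where
  "levels = range (\<lambda>r. (lift_level ^^ r) N)"

lemma N_in_levels: "N \<in> levels"
  unfolding levels_def by (rule range_eqI[of _ _ 0]) simp

lemma lift_level_in_levels:
  assumes "j \<in> levels"
  shows "lift_level j \<in> levels"
proof -
  obtain r where "j = (lift_level ^^ r) N" using assms unfolding levels_def by blast
  then have "lift_level j = (lift_level ^^ Suc r) N" by simp
  then show ?thesis unfolding levels_def by (rule range_eqI)
qed

lemma levels_le: "j \<in> levels \<Longrightarrow> j \<le> N"
proof -
  have "(lift_level ^^ r) N \<le> N" for r
    by (induction r) (auto intro: order_trans[OF lift_level_le])
  then show "j \<in> levels \<Longrightarrow> j \<le> N" unfolding levels_def by auto
qed

text \<open>Feeds the recursion in \<open>expressible_agree\<close>. The two ends, equality and the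
  total relation, need no symbol; any other height is \<open>lift_level\<close> of a strictly deeper
  one.\<close>

lemma levels_cases:
  assumes "j \<in> levels"
  obtains "j = N" | "j = 0" | i where "i \<in> levels" "j = lift_level i" "j < i"
proof -
  obtain r where r: "j = (lift_level ^^ r) N" using assms unfolding levels_def by auto
  show ?thesis
  proof (cases r)
    case 0
    then show ?thesis using r that(1) by simp
  next
    case (Suc r')
    define i where "i = (lift_level ^^ r') N"
    have "i \<in> levels" "j = lift_level i" unfolding levels_def using r Suc by (auto simp: i_def)
    then show ?thesis using that(2,3) lift_level_less lift_level_le[of i] by (cases "i = 0") auto
  qed
qed

text \<open>For \<open>j > 0\<close>, agreement at all smaller heights of \<open>levels\<close>
  includes agreement at \<open>lift_level j\<close>, because \<open>levels\<close> is closed under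
  \<open>lift_level\<close>. So the swaps demanded by \<open>homogeneous\<close> preserve
  \<open>X\<close>.\<close>

lemma levels_invariant:
  assumes "zs \<in> tuples T k" "ws \<in> tuples T k" "same_types levels zs ws" "zs \<in> X"
  shows "ws \<in> X"
proof (rule homogeneous[OF N_in_levels _ assms(1,4,2,3)])
  fix j x y us
  assume j: "j \<in> levels" and xy: "x \<in> T" "y \<in> T" "\<And>m. m \<in> levels \<Longrightarrow> m < j \<Longrightarrow> agree m x y"
    and us: "us \<in> tuples T k" "us \<in> X"
  have "swappable j x y"
  proof (cases "j = 0")
    case True
    then show ?thesis by (simp add: swappable_if_agree)
  next
    case False
    then show ?thesis
      using xy lift_level_less lift_level_in_levels[OF j] by (intro swappable_if_agree_lift) auto
  qed
  then show "map (swap j x y) us \<in> X" using us unfolding swappable_def by blast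
qed

text \<open>A swap need not be definable, so its graph on tuples is replaced by a condition on
  agreements at \<open>j\<close> and at the heights of \<open>levels\<close> from \<open>j\<close>
  on. Any \<open>ws\<close> satisfying it has the same type over \<open>levels\<close> as the true
  image of \<open>zs\<close>, and by \<open>levels_invariant\<close> \<open>X\<close> cannot tell
  the two apart.\<close>

lemma swappable_iff_types:
  assumes "x \<in> T" "y \<in> T"
  shows "swappable j x y \<longleftrightarrow> \<not> (\<exists>zs \<in> tuples T k. \<exists>ws \<in> tuples T k.
    same_types (levels \<inter> {j..}) zs ws \<and> (\<forall>a<k. agree j (swap j x y (zs ! a)) (ws ! a)) \<and>
    zs \<in> X \<and> ws \<notin> X)" (is "_ \<longleftrightarrow> \<not> ?R")
proof
  assume sw: "swappable j x y"
  show "\<not> ?R"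
  proof
    assume ?R
    then obtain zs ws where zs: "zs \<in> tuples T k" "zs \<in> X" and ws: "ws \<in> tuples T k" "ws \<notin> X"
      and st: "same_types (levels \<inter> {j..}) zs ws"
      and cl: "\<And>a. a < k \<Longrightarrow> agree j (swap j x y (zs ! a)) (ws ! a)" by blast
    let ?z = "map (swap j x y) zs"
    have "same_types (levels \<inter> {j..}) ?z zs" by (rule same_types_swap) auto
    then have "same_types levels ?z ws"
      using zs cl by (intro same_types_if_close[OF same_types_trans[OF _ st]]) (auto simp: tuples_def)
    moreover have "?z \<in> X" "?z \<in> tuples T k"
      using sw zs assms swap_map_tuples unfolding swappable_def by blast+
    ultimately show False using levels_invariant ws by blast
  qed
next
  assume R: "\<not> ?R"
  show "swappable j x y"
    unfolding swappable_def
  proof (intro ballI impI)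
    fix zs assume zs: "zs \<in> tuples T k" "zs \<in> X"
    have "same_types (levels \<inter> {j..}) zs (map (swap j x y) zs)"
      by (intro same_types_sym[OF same_types_swap]) auto
    moreover have "map (swap j x y) zs \<in> tuples T k" using zs assms swap_map_tuples by blast
    moreover have "\<forall>a<k. agree j (swap j x y (zs ! a)) (map (swap j x y) zs ! a)"
      using zs by (auto simp: tuples_def)
    ultimately show "map (swap j x y) zs \<in> X" using R zs by blast
  qed
qed

lemma expressible_agree_step:
  fixes a b :: nat
  assumes r: "r \<in> L" "ar r = k" "D r = X"
    and above: "\<And>m p q. m \<in> levels \<Longrightarrow> j \<le> m \<Longrightarrow> expressible T L ar D (\<lambda>v. agree m (v p) (v q))"
    and j: "j \<in> levels"
  shows "expressible T L ar D (\<lambda>v. agree (lift_level j) (v a) (v b))"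
proof -
  \<comment> \<open>Variables from \<open>c\<close> on are fresh; the first \<open>2 * k\<close> of
    them hold the tuples \<open>zs\<close> and \<open>ws\<close>.\<close>
  define c where "c = Suc (max a b)"
  define Z where "Z v = map v [c..<c + k]" for v :: "nat \<Rightarrow> nat \<Rightarrow> nat"
  define W where "W v = map v [c + k..<c + 2 * k]" for v :: "nat \<Rightarrow> nat \<Rightarrow> nat"
  define C where "C v \<longleftrightarrow> same_types (levels \<inter> {j..}) (Z v) (W v) \<and>
      (\<forall>i<k. agree j (swap j (v a) (v b) (Z v ! i)) (W v ! i))" for v
  have ZW: "length (Z v) = k" "length (W v) = k"
    "\<And>i. i < k \<Longrightarrow> Z v ! i = v (c + i)" "\<And>i. i < k \<Longrightarrow> W v ! i = v (c + k + i)" for v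
    by (auto simp: Z_def W_def)
  have fin: "finite ((levels \<inter> {j..}) \<times> {..<c + 2 * k} \<times> {..<c + 2 * k})"
    using finite_subset[of levels "{..N}"] levels_le by auto
  have "expressible T L ar D C"
  \<comment> \<open>Unfolding the swap by \<open>agree_swap_iff\<close> leaves agreements of
    finitely many variables at heights of \<open>levels\<close> from \<open>j\<close> on,
    \<open>j\<close> itself being one of them.\<close>
  proof (rule expressible_determined[OF fin, where Q = "\<lambda>(m, p, q) v. agree m (v p) (v q)"])
    fix z assume "z \<in> (levels \<inter> {j..}) \<times> {..<c + 2 * k} \<times> {..<c + 2 * k}"
    then show "expressible T L ar D ((\<lambda>(m, p, q) v. agree m (v p) (v q)) z)"
      by (auto intro: above)
  next
    fix v w
    assume "\<And>z. z \<in> (levels \<inter> {j..}) \<times> {..<c + 2 * k} \<times> {..<c + 2 * k} \<Longrightarrow>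
      (\<lambda>(m, p, q) v. agree m (v p) (v q)) z v = (\<lambda>(m, p, q) v. agree m (v p) (v q)) z w"
    then have *: "agree m (v p) (v q) \<longleftrightarrow> agree m (w p) (w q)"
      if "m \<in> levels \<inter> {j..}" "p < c + 2 * k" "q < c + 2 * k" for m p q
      using that by fastforce
    have "same_types (levels \<inter> {j..}) (Z v) (W v) \<longleftrightarrow> same_types (levels \<inter> {j..}) (Z w) (W w)"
      unfolding same_types_def ZW(1,2) by (simp add: ZW *)
    moreover have "a < c + 2 * k" "b < c + 2 * k" by (auto simp: c_def)
    ultimately show "C v = C w"
      unfolding C_def using j by (simp add: ZW agree_swap_iff *)
  qed
  moreover have "expressible T L ar D (\<lambda>v. Z v \<in> X)" "expressible T L ar D (\<lambda>v. W v \<in> X)"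
    unfolding Z_def W_def r(3)[symmetric] using r by (auto intro!: expressible_rel)
  ultimately have "expressible T L ar D (\<lambda>v. C v \<and> Z v \<in> X \<and> \<not> W v \<in> X)"
    by (intro expressible_conj expressible_not)
  from expressible_not[OF expressible_ex[OF _ this, of "{c..<c + 2 * k}"]]
  have "expressible T L ar D (\<lambda>v. \<not> (\<exists>w. (\<forall>i. w i \<in> T) \<and>
      (\<forall>i. i \<notin> {c..<c + 2 * k} \<longrightarrow> w i = v i) \<and> C w \<and> Z w \<in> X \<and> \<not> W w \<in> X))"
    by simp
  then show ?thesis
  proof (rule expressible_cong)
    fix v :: "nat \<Rightarrow> nat \<Rightarrow> nat"
    assume v: "\<And>i. v i \<in> T"
    have ab: "a \<notin> {c..<c + 2 * k}" "b \<notin> {c..<c + 2 * k}" by (auto simp: c_def)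
    have "(\<exists>w. (\<forall>i. w i \<in> T) \<and> (\<forall>i. i \<notin> {c..<c + 2 * k} \<longrightarrow> w i = v i) \<and>
        C w \<and> Z w \<in> X \<and> W w \<notin> X) \<longleftrightarrow>
      (\<exists>zs \<in> tuples T k. \<exists>ws \<in> tuples T k. same_types (levels \<inter> {j..}) zs ws \<and>
        (\<forall>i<k. agree j (swap j (v a) (v b) (zs ! i)) (ws ! i)) \<and> zs \<in> X \<and> ws \<notin> X)" (is "?l \<longleftrightarrow> ?r")
    proof
      assume ?l
      then obtain w where w: "\<forall>i. w i \<in> T" "\<forall>i. i \<notin> {c..<c + 2 * k} \<longrightarrow> w i = v i"
        "C w" "Z w \<in> X" "W w \<notin> X" by blast
      have "w a = v a" "w b = v b" using w(2) ab by auto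
      then have "same_types (levels \<inter> {j..}) (Z w) (W w)"
        "\<forall>i<k. agree j (swap j (v a) (v b) (Z w ! i)) (W w ! i)"
        using w(3) unfolding C_def by auto
      moreover have "Z w \<in> tuples T k" "W w \<in> tuples T k"
        using w(1) by (auto simp: Z_def W_def tuples_def)
      ultimately show ?r using w(4,5) by blast
    next
      assume ?r
      then obtain zs ws where zw: "zs \<in> tuples T k" "ws \<in> tuples T k"
        "same_types (levels \<inter> {j..}) zs ws"
        "\<forall>i<k. agree j (swap j (v a) (v b) (zs ! i)) (ws ! i)" "zs \<in> X" "ws \<notin> X" by blast
      define w where "w i = (if i \<in> {c..<c + k} then zs ! (i - c)
        else if i \<in> {c + k..<c + 2 * k} then ws ! (i - (c + k)) else v i)" for i
      have len: "length zs = k" "length ws = k" using zw by (auto simp: tuples_def)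
      have ZWw: "Z w = zs" "W w = ws"
        by (rule nth_equalityI; simp add: ZW len w_def)+
      have "zs ! i \<in> T" "ws ! i \<in> T" if "i < k" for i
        using zw(1,2) that by (auto simp: tuples_def)
      then have wT: "w i \<in> T" for i
        using v by (auto simp: w_def)
      have out: "w i = v i" if "i \<notin> {c..<c + 2 * k}" for i
        using that by (auto simp: w_def)
      have "C w" unfolding C_def ZWw out[OF ab(1)] out[OF ab(2)] using zw(3,4) by blast
      then show ?l using wT out ZWw zw(5,6) by blast
    qed
    \<comment> \<open>The negated condition is swappability, which is agreement at
      \<open>lift_level j\<close>.\<close>
    then show "(\<not> (\<exists>w. (\<forall>i. w i \<in> T) \<and> (\<forall>i. i \<notin> {c..<c + 2 * k} \<longrightarrow> w i = v i) \<and>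
        C w \<and> Z w \<in> X \<and> W w \<notin> X)) = agree (lift_level j) (v a) (v b)"
      using swappable_iff_types[OF v v, of j a b]
        agree_lift_if_swappable[OF v v _ levels_le[OF j], of a b]
        swappable_if_agree_lift[OF v v, of j a b] by blast
  qed
qed

text \<open>The induction starts at the bottom: expressing \<open>lift_level i\<close> uses all
  heights of \<open>levels\<close> from \<open>i\<close> on, and these are deeper than
  \<open>lift_level i\<close>.\<close>

lemma expressible_agree:
  fixes a b :: nat
  assumes r: "r \<in> L" "ar r = k" "D r = X"
  shows "j \<in> levels \<Longrightarrow> expressible T L ar D (\<lambda>v. agree j (v a) (v b))"
proof (induction "N - j" arbitrary: j a b rule: less_induct)
  case less
  from less.prems show ?case
  proof (cases rule: levels_cases)
    case 1
    show ?thesis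
      by (rule expressible_cong[OF expressible_eq[of _ _ _ _ a b]]) (simp add: 1 agree_eq[of _ N \<delta>])
  next
    case 2
    then show ?thesis using expressible_const[of _ _ _ _ True] by simp
  next
    case (3 i)
    show ?thesis unfolding 3(2)
    proof (rule expressible_agree_step[of r L ar D, OF r _ 3(1)])
      fix m p q
      assume m: "m \<in> levels" "i \<le> m"
      have "N - m < N - j" using m levels_le[OF m(1)] 3(3) by simp
      then show "expressible T L ar D (\<lambda>v. agree m (v p) (v q))" using less.hyps m by blast
    qed
  qed
qed

end

section \<open>Models of REF\<close>

text \<open>Each class properly contains a class of the next level, and this never ends. It makes
  the last step of the chain, from \<open>E n\<close> to equality, split uniformly.\<close>

lemma REF_class_infinite:
  assumes REF: "REF M E" and C: "C \<in> M // E n"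
  shows "infinite C"
proof
  assume "finite C"
  then show False using C
  proof (induction "card C" arbitrary: C n rule: less_induct)
    case less
    have eq: "equiv M (E m)" for m using REF by (simp add: REF_def)
    have sub: "E (Suc n) \<subseteq> E n" using REF by (simp add: REF_def)
    obtain s where s: "s \<in> M" "C = E n `` {s}" using less.prems(2) by (rule quotientE)
    have CM: "C \<subseteq> M" using s eq[of n] by (auto simp: equiv_def refl_on_def)
    let ?Q = "\<lambda>x. E (Suc n) `` {x}"
    have Q: "?Q x \<subseteq> C" "x \<in> ?Q x" if "x \<in> C" for x
    proof -
      show "x \<in> ?Q x" using that CM by (intro equiv_class_self[OF eq]) auto
      have "(s, x) \<in> E n" using that s(2) by simp
      then show "?Q x \<subseteq> C" using sub eq[of n] unfolding s(2) equiv_def by (blast dest: transD)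
    qed
    have two: "2 \<le> ecard (C // E (Suc n))"
      using REF less.prems(2) unfolding REF_def by metis
    have "s \<in> C" unfolding s(2) using s(1) by (rule equiv_class_self[OF eq])
    have "\<exists>x\<in>C. ?Q x \<noteq> ?Q s"
    proof (rule ccontr)
      assume "\<not> ?thesis"
      then have "C // E (Suc n) \<subseteq> {?Q s}" by (auto simp: quotient_def)
      then have "ecard (C // E (Suc n)) \<le> 1"
        using card_mono[of "{?Q s}" "C // E (Suc n)"] finite_subset[of _ "{?Q s}"]
        by (simp add: ecard_def one_enat_def)
      with two have "(2 :: enat) \<le> 1" by (rule order_trans)
      then show False by (simp add: one_enat_def numeral_eq_enat)
    qed
    then obtain x where x: "x \<in> C" "?Q x \<noteq> ?Q s" by blast
    have "s \<notin> ?Q x"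
    proof
      assume "s \<in> ?Q x"
      then have "(x, s) \<in> E (Suc n)" by simp
      then show False using equiv_class_eq[OF eq] x(2) by blast
    qed
    then have "?Q x \<subset> C" using Q(1)[OF x(1)] \<open>s \<in> C\<close> by blast
    then have "card (?Q x) < card C" "finite (?Q x)"
      using less.prems(1) psubset_card_mono finite_subset by blast+
    moreover have "?Q x \<in> M // E (Suc n)" using x(1) CM by (blast intro: quotientI)
    ultimately show False using less.hyps by blast
  qed
qed

text \<open>Shifted by one: index \<open>Suc l\<close> is \<open>E l\<close>, below the total relation and above equality.\<close>

definition ref_chain :: "'a set \<Rightarrow> (nat \<Rightarrow> ('a \<times> 'a) set) \<Rightarrow> nat \<Rightarrow> nat \<Rightarrow> ('a \<times> 'a) set" where
  "ref_chain M E n m = (case m of 0 \<Rightarrow> M \<times> M | Suc l \<Rightarrow> if l \<le> n then E l else Id_on M)"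

lemma splitting_chain_REF:
  assumes REF: "REF M E"
  shows "\<exists>\<delta>. splitting_chain M (ref_chain M E n) (Suc (Suc n)) \<delta> \<and> (\<forall>m<Suc (Suc n). 1 \<le> \<delta> m)"
proof -
  let ?F = "ref_chain M E n"
  obtain \<epsilon> :: "nat \<Rightarrow> enat" where \<epsilon>: "\<And>l. 2 \<le> \<epsilon> l"
    "\<And>l C. C \<in> M // E l \<Longrightarrow> ecard (C // E (Suc l)) = \<epsilon> l"
    using REF unfolding REF_def by blast
  have M: "M \<noteq> {}" and eq: "\<And>l. equiv M (E l)" and dec: "\<And>l. E (Suc l) \<subseteq> E l"
    using REF by (auto simp: REF_def)
  \<comment> \<open>Height 0 counts the \<open>E 0\<close>-classes. There may be only one, which is
    why the lower bound is 1 and not 2. Below \<open>E n\<close> every class falls into infinitely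
    many points.\<close>
  define \<delta> where "\<delta> m = (case m of 0 \<Rightarrow> ecard (M // E 0) | Suc l \<Rightarrow> if l < n then \<epsilon> l else \<infinity>)" for m
  have eqF: "equiv M (?F m)" for m
  proof -
    have "equiv M (M \<times> M)" by (auto simp: equiv_def refl_on_def sym_def trans_def)
    moreover have "equiv M (Id_on M)" by (auto simp: equiv_def refl_on_def sym_def trans_def)
    ultimately show ?thesis using eq by (simp add: ref_chain_def split: nat.split)
  qed
  have subM: "E l \<subseteq> M \<times> M" for l using eq[of l] by (auto simp: equiv_def refl_on_def)
  have decF: "?F (Suc m) \<subseteq> ?F m" for m
  proof -
    have "Id_on M \<subseteq> E l" for l using eq[of l] by (auto simp: equiv_def refl_on_def)
    then show ?thesis using dec subM by (auto simp: ref_chain_def split: nat.split)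
  qed
  have card: "ecard (C // ?F (Suc m)) = \<delta> m" if m: "m < Suc (Suc n)" and C: "C \<in> M // ?F m" for m C
  proof (cases m)
    case 0
    then have "C = M" using C by (auto simp: ref_chain_def quotient_def)
    then show ?thesis using 0 by (simp add: ref_chain_def \<delta>_def)
  next
    case (Suc l)
    then have ln: "l \<le> n" using m by simp
    then have CE: "C \<in> M // E l" using C Suc by (simp add: ref_chain_def)
    show ?thesis
    proof (cases "l < n")
      case True
      then show ?thesis using \<epsilon>(2)[OF CE] Suc by (simp add: ref_chain_def \<delta>_def)
    next
      case False
      have CM: "C \<subseteq> M" using CE subM by (auto simp: quotient_def)
      have "bij_betw (\<lambda>x. {x}) C (C // Id_on M)"
      proof (rule bij_betw_imageI)
        show "(\<lambda>x. {x}) ` C = C // Id_on M" using CM by (auto simp: quotient_def)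
      qed simp
      then have "infinite (C // Id_on M)"
        using REF_class_infinite[OF REF CE] by (simp add: bij_betw_finite)
      then show ?thesis using False Suc ln by (simp add: ref_chain_def \<delta>_def ecard_def)
    qed
  qed
  have "1 \<le> \<delta> m" for m
  proof (cases m)
    case 0
    have "M // E 0 \<noteq> {}" using M by (auto simp: quotient_def)
    then have "finite (M // E 0) \<Longrightarrow> 1 \<le> card (M // E 0)" by (simp add: Suc_le_eq card_gt_0_iff)
    then show ?thesis using 0 by (simp add: \<delta>_def ecard_def one_enat_def)
  next
    case (Suc l)
    have "1 \<le> \<epsilon> l" using \<epsilon>(1)[of l] by (rule order_trans[rotated]) simp
    then show ?thesis using Suc by (simp add: \<delta>_def)
  qed
  moreover have "splitting_chain M ?F (Suc (Suc n)) \<delta>"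
    using M eqF decF card unfolding splitting_chain_def by (simp add: ref_chain_def)
  ultimately show ?thesis by blast
qed

section \<open>Transfer between the model and the tree\<close>

lemma mem_pairs: "length xs = 2 \<Longrightarrow> map v xs \<in> pairs R \<longleftrightarrow> (v (xs ! 0), v (xs ! 1)) \<in> R"
  by (cases xs; cases "tl xs") (auto simp: pairs_def)

text \<open>Serves twice: between the model and its tree it carries over the defining formula, and
  within the tree it yields the invariance of the relation.\<close>

lemma sat_same_type_pairs:
  assumes M: "splitting_chain M F N \<delta>" and M': "splitting_chain M' F' N \<delta>"
    and \<phi>: "in_language {..n} (\<lambda>_. 2) \<phi>" "fv \<phi> \<subseteq> {..<k}" and n: "n < N"
    and D: "\<And>r. r \<le> n \<Longrightarrow> D r = pairs (F (Suc r))" "\<And>r. r \<le> n \<Longrightarrow> D' r = pairs (F' (Suc r))"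
    and xs: "xs \<in> tuples M k" "xs' \<in> tuples M' k"
    and st: "same_type N F F' {..<k} (nth xs) (nth xs')"
  shows "sat M D (nth xs) \<phi> \<longleftrightarrow> sat M' D' (nth xs') \<phi>"
proof (rule sat_same_type[OF M M' _ \<phi>(1) _ _ _ \<phi>(2) st])
  show "nth xs ` {..<k} \<subseteq> M" "nth xs' ` {..<k} \<subseteq> M'" using xs by (auto simp: tuples_def)
  fix r :: nat and ys :: "nat list" and v v'
  assume r: "r \<in> {..n}" "length ys = 2" and st: "same_type N F F' (set ys) v v'"
  have "ys ! 0 \<in> set ys" "ys ! 1 \<in> set ys" using r(2) by auto
  then have "(v (ys ! 0), v (ys ! 1)) \<in> F (Suc r) \<longleftrightarrow> (v' (ys ! 0), v' (ys ! 1)) \<in> F' (Suc r)"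
    using st r(1) n unfolding same_type_def by auto
  then show "map v ys \<in> D r \<longleftrightarrow> map v' ys \<in> D' r" using r D by (simp add: mem_pairs)
qed simp

text \<open>Only the symbol \<open>i\<close> may occur when the \<open>E j\<close> are recovered;
  this lets the sets \<open>J\<close> of different relations be united.\<close>

lemma single_relation:
  fixes M :: "'a set" and i :: 'i
  assumes REF: "REF M E" and def: "definable M UNIV (\<lambda>_. 2) (\<lambda>n. pairs (E n)) (k i) (D i)"
  shows "\<exists>J. (\<forall>j\<in>J. definable M {i} k D 2 (pairs (E j))) \<and>
    definable M J (\<lambda>_. 2) (\<lambda>n. pairs (E n)) (k i) (D i)"
proof -
  obtain \<phi> where \<phi>: "in_language UNIV (\<lambda>_. 2) \<phi>" "fv \<phi> \<subseteq> {..<k i}"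
    and Di: "D i = {xs \<in> tuples M (k i). sat M (\<lambda>n. pairs (E n)) (nth xs) \<phi>}"
    using def unfolding definable_def by blast
  obtain n where n: "in_language {..n} (\<lambda>_. 2) \<phi>"
    using in_language_finite_support \<phi>(1) by blast
  define F where "F = ref_chain M E n"
  define N where "N = Suc (Suc n)"
  obtain \<delta> where M: "splitting_chain M F N \<delta>" and \<delta>: "\<And>m. m < N \<Longrightarrow> 1 \<le> \<delta> m"
    using splitting_chain_REF[OF REF] unfolding F_def N_def by blast
  define T where "T = tree N \<delta>"
  define G where "G = tree_rel N \<delta>"
  have T: "splitting_chain T G N \<delta>" unfolding T_def G_def using \<delta> by (rule splitting_chain_tree)
  have FE: "F (Suc l) = E l" if "l \<le> n" for l using that by (simp add: F_def ref_chain_def)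
  have Mne: "M \<noteq> {}" using REF by (simp add: REF_def)
  \<comment> \<open>The copy of \<open>D i\<close> in the tree: the same formula, with
    \<open>E m\<close> read as agreement up to \<open>Suc m\<close>.\<close>
  define X where "X = {xs \<in> tuples T (k i). sat T (\<lambda>m. pairs (G (Suc m))) (nth xs) \<phi>}"
  have DX: "map v xs \<in> D i \<longleftrightarrow> map v' xs \<in> X"
    if "length xs = k i" "v ` set xs \<subseteq> M" "v' ` set xs \<subseteq> T" "same_type N F G (set xs) v v'"
    for v v' and xs :: "nat list"
  proof -
    have tup: "map v xs \<in> tuples M (k i)" "map v' xs \<in> tuples T (k i)"
      using that by (auto simp: tuples_def)
    have "sat M (\<lambda>n. pairs (E n)) (nth (map v xs)) \<phi> \<longleftrightarrow>
        sat T (\<lambda>m. pairs (G (Suc m))) (nth (map v' xs)) \<phi>"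
    proof (rule sat_same_type_pairs[OF M T n \<phi>(2) _ _ _ tup])
      show "same_type N F G {..<k i} (nth (map v xs)) (nth (map v' xs))"
        using that(1,4) unfolding same_type_def by simp
    qed (simp_all add: FE N_def)
    then show ?thesis using tup by (simp add: Di X_def)
  qed
  interpret invariant_relation N \<delta> "k i" X
  proof
    fix zs ws
    assume zs: "zs \<in> tuples (tree N \<delta>) (k i)" "zs \<in> X" and ws: "ws \<in> tuples (tree N \<delta>) (k i)"
      and st: "same_types {..N} zs ws"
    have "sat T (\<lambda>m. pairs (G (Suc m))) (nth zs) \<phi> \<longleftrightarrow> sat T (\<lambda>m. pairs (G (Suc m))) (nth ws) \<phi>"
    proof (rule sat_same_type_pairs[OF T T n \<phi>(2)])
      have "zs ! a \<in> tree N \<delta>" "ws ! a \<in> tree N \<delta>" if "a < k i" for a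
        using that zs ws by (auto simp: tuples_def)
      moreover have "length zs = k i" using zs by (simp add: tuples_def)
      ultimately show "same_type N G G {..<k i} (nth zs) (nth ws)"
        using st by (simp add: same_type_def same_types_def G_def tree_rel_def)
    qed (use zs ws in \<open>simp_all add: N_def T_def\<close>)
    then show "ws \<in> X" using zs ws by (simp add: X_def T_def)
  qed
  \<comment> \<open>Height \<open>Suc l\<close> is \<open>E l\<close>. The heights 0 and
    \<open>N\<close> of \<open>levels\<close> are left out, being the total relation and
    equality.\<close>
  define J where "J = {l. l \<le> n \<and> Suc l \<in> levels}"
  have "definable M {i} k D 2 (pairs (E j))" if j: "j \<in> J" for j
  proof (rule definable_if_expressible[OF Mne, where P = "\<lambda>v. (v 0, v 1) \<in> E j"])
    have jn: "j \<le> n" "Suc j \<in> levels" using j by (auto simp: J_def)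
    obtain \<psi> where \<psi>: "in_language {i} k \<psi>"
      "\<And>v. (\<forall>l. v l \<in> T) \<Longrightarrow> sat T (\<lambda>_. X) v \<psi> \<longleftrightarrow> agree (Suc j) (v 0) (v 1)"
      using expressible_agree[of i "{i}" k "\<lambda>_. X" "Suc j" 0 1] jn(2)
      unfolding expressible_def T_def by auto
    have "sat M D v \<psi> \<longleftrightarrow> (v 0, v 1) \<in> E j" if v: "\<forall>l. v l \<in> M" for v
    proof -
      \<comment> \<open>The variables 0 and 1 are added because the type has to decide
        \<open>(v 0, v 1)\<close> as well.\<close>
      let ?S = "fv \<psi> \<union> {0, 1}"
      obtain v' where v': "\<forall>l. v' l \<in> T" "same_type N F G ?S v v'"
        using same_type_copy[OF M T, of ?S v] v by auto
      have "sat M D v \<psi> \<longleftrightarrow> sat T (\<lambda>_. X) v' \<psi>"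
      proof (rule sat_same_type[OF M T _ \<psi>(1) _ _ _ _ v'(2)])
        show "map u xs \<in> D r \<longleftrightarrow> map u' xs \<in> X"
          if "r \<in> {i}" "length xs = k r" "u ` set xs \<subseteq> M" "u' ` set xs \<subseteq> T"
            "same_type N F G (set xs) u u'" for r u u' and xs :: "nat list"
          using DX that by auto
      qed (use v v'(1) in auto)
      also have "\<dots> \<longleftrightarrow> (v' 0, v' 1) \<in> G (Suc j)"
        using \<psi>(2) v'(1) by (simp add: G_def tree_rel_def T_def)
      also have "\<dots> \<longleftrightarrow> (v 0, v 1) \<in> F (Suc j)"
        using v'(2) jn(1) unfolding same_type_def N_def by auto
      finally show ?thesis using FE jn(1) by simp
    qed
    then show "expressible M {i} k D (\<lambda>v. (v 0, v 1) \<in> E j)"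
      unfolding expressible_def using \<psi>(1) by blast
    have "E j \<subseteq> M \<times> M" using REF by (auto simp: REF_def equiv_def refl_on_def)
    then show "pairs (E j) \<subseteq> tuples M 2" by (auto simp: pairs_def tuples_def)
    show "map v [0..<2] \<in> pairs (E j) \<longleftrightarrow> (v 0, v 1) \<in> E j" for v
      by (simp add: mem_pairs)
  qed simp
  moreover have "definable M J (\<lambda>_. 2) (\<lambda>n. pairs (E n)) (k i) (D i)"
  proof (rule definable_if_expressible[OF Mne, where P = "\<lambda>v. map v [0..<k i] \<in> D i"])
    have fin: "finite (levels \<times> {..<k i} \<times> {..<k i})"
      using finite_subset[of levels "{..N}"] levels_le by auto
    show "expressible M J (\<lambda>_. 2) (\<lambda>n. pairs (E n)) (\<lambda>v. map v [0..<k i] \<in> D i)"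
    \<comment> \<open>Two valuations with the same atoms at the heights in \<open>levels\<close> are
      copied into the tree, where \<open>levels_invariant\<close> makes \<open>X\<close> treat the
      copies alike.\<close>
    proof (rule expressible_determined[OF fin, where Q = "\<lambda>(m, a, b) v. (v a, v b) \<in> F m"])
      fix z assume "z \<in> levels \<times> {..<k i} \<times> {..<k i}"
      then obtain m a b where z: "z = (m, a, b)" "m \<in> levels" by auto
      have "expressible M J (\<lambda>_. 2) (\<lambda>n. pairs (E n)) (\<lambda>v. (v a, v b) \<in> F m)"
      proof (cases m)
        case 0
        show ?thesis
          by (rule expressible_cong[OF expressible_const[of _ _ _ _ True]])
            (simp add: 0 F_def ref_chain_def)
      next
        case (Suc l)
        show ?thesis
        proof (cases "l \<le> n")
          case True
          then have "l \<in> J" using z Suc by (simp add: J_def)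
          then have "expressible M J (\<lambda>_. 2) (\<lambda>n. pairs (E n)) (\<lambda>v. map v [a, b] \<in> pairs (E l))"
            by (rule expressible_rel) simp
          then show ?thesis
            by (rule expressible_cong) (simp add: Suc FE True pairs_def)
        next
          case False
          then have "m = N" using levels_le[OF z(2)] Suc by (simp add: N_def)
          show ?thesis
            by (rule expressible_cong[OF expressible_eq[of _ _ _ _ a b]])
              (simp add: \<open>m = N\<close> splitting_chain_bottom[OF M] Id_on_iff)
        qed
      qed
      then show "expressible M J (\<lambda>_. 2) (\<lambda>n. pairs (E n)) ((\<lambda>(m, a, b) v. (v a, v b) \<in> F m) z)"
        by (simp add: z)
    next
      fix v w
      assume v: "\<And>l. v l \<in> M" and w: "\<And>l. w l \<in> M"
        and Q: "\<And>z. z \<in> levels \<times> {..<k i} \<times> {..<k i} \<Longrightarrow>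
          (\<lambda>(m, a, b) v. (v a, v b) \<in> F m) z v = (\<lambda>(m, a, b) v. (v a, v b) \<in> F m) z w"
      obtain v' where v': "\<forall>l. v' l \<in> T" "same_type N F G {..<k i} v v'"
        using same_type_copy[OF M T, of "{..<k i}" v] v by auto
      obtain w' where w': "\<forall>l. w' l \<in> T" "same_type N F G {..<k i} w w'"
        using same_type_copy[OF M T, of "{..<k i}" w] w by auto
      let ?zs = "map v' [0..<k i]" and ?ws = "map w' [0..<k i]"
      have tup: "?zs \<in> tuples (tree N \<delta>) (k i)" "?ws \<in> tuples (tree N \<delta>) (k i)"
        using v'(1) w'(1) by (auto simp: tuples_def T_def)
      have "agree m (v' a) (v' b) \<longleftrightarrow> agree m (w' a) (w' b)"
        if "m \<in> levels" "a < k i" "b < k i" for m a b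
      proof -
        have mN: "m \<le> N" using levels_le that(1) by blast
        have "agree m (v' a) (v' b) \<longleftrightarrow> (v' a, v' b) \<in> G m"
          using v'(1) by (simp add: G_def tree_rel_def T_def)
        also have "\<dots> \<longleftrightarrow> (v a, v b) \<in> F m"
          using v'(2) that mN unfolding same_type_def by auto
        also have "\<dots> \<longleftrightarrow> (w a, w b) \<in> F m" using Q[of "(m, a, b)"] that by simp
        also have "\<dots> \<longleftrightarrow> (w' a, w' b) \<in> G m"
          using w'(2) that mN unfolding same_type_def by auto
        also have "\<dots> \<longleftrightarrow> agree m (w' a) (w' b)"
          using w'(1) by (simp add: G_def tree_rel_def T_def)
        finally show ?thesis .
      qed
      then have st: "same_types levels ?zs ?ws" by (simp add: same_types_def)
      have "?zs \<in> X \<longleftrightarrow> ?ws \<in> X"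
        using levels_invariant[OF tup st] levels_invariant[OF tup(2,1) same_types_sym[OF st]] by blast
      moreover have "map u [0..<k i] \<in> D i \<longleftrightarrow> map u' [0..<k i] \<in> X"
        if "\<And>l. u l \<in> M" "\<forall>l. u' l \<in> T" "same_type N F G {..<k i} u u'" for u u'
      proof (rule DX)
        have "set [0..<k i] = {..<k i}" by auto
        then show "same_type N F G (set [0..<k i]) u u'" using that(3) by (simp only:)
      qed (use that(1,2) in auto)
      ultimately show "(map v [0..<k i] \<in> D i) = (map w [0..<k i] \<in> D i)"
        using v v' w w' by blast
    qed
    show "D i \<subseteq> tuples M (k i)" unfolding Di by blast
    show "(map v [0..<k i] \<in> D i) = (map w [0..<k i] \<in> D i)"
      if "\<And>l. l < k i \<Longrightarrow> v l = w l" for v w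
    proof -
      have "map v [0..<k i] = map w [0..<k i]" by (rule map_cong) (simp_all add: that)
      then show ?thesis by (rule arg_cong)
    qed
  qed (rule refl)
  ultimately show ?thesis by blast
qed

theorem theoremA3:
  fixes M :: "'a set" and E :: "nat \<Rightarrow> ('a \<times> 'a) set"
    and I :: "'i set" and k :: "'i \<Rightarrow> nat" and D :: "'i \<Rightarrow> 'a list set"
  assumes "REF M E"
    and "\<And>i. i \<in> I \<Longrightarrow> definable M UNIV (\<lambda>_. 2) (\<lambda>n. pairs (E n)) (k i) (D i)"
  shows "\<exists>J :: nat set. definably_equivalent M I k D J (\<lambda>_. 2) (\<lambda>n. pairs (E n))"
proof -
  have "\<forall>i\<in>I. \<exists>J. (\<forall>j\<in>J. definable M {i} k D 2 (pairs (E j))) \<and>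
      definable M J (\<lambda>_. 2) (\<lambda>n. pairs (E n)) (k i) (D i)"
    by (intro ballI single_relation[OF assms(1)] assms(2))
  from bchoice[OF this] obtain J where J: "\<forall>i\<in>I. (\<forall>j\<in>J i. definable M {i} k D 2 (pairs (E j))) \<and>
      definable M (J i) (\<lambda>_. 2) (\<lambda>n. pairs (E n)) (k i) (D i)" ..
  \<comment> \<open>Definability survives enlarging the language, so the definition of
    \<open>E j\<close> from one \<open>D i\<close> and that of \<open>D i\<close> from
    \<open>J i\<close> both persist.\<close>
  have "definably_equivalent M I k D (\<Union>i\<in>I. J i) (\<lambda>_. 2) (\<lambda>n. pairs (E n))"
    unfolding definably_equivalent_def
  proof (intro conjI ballI)
    fix j assume "j \<in> (\<Union>i\<in>I. J i)"
    then obtain i where i: "i \<in> I" "j \<in> J i" by blast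
    then have "definable M {i} k D 2 (pairs (E j))" using J by blast
    then show "definable M I k D 2 (pairs (E j))" by (rule definable_mono) (use i in blast)
  next
    fix i assume i: "i \<in> I"
    then have "definable M (J i) (\<lambda>_. 2) (\<lambda>n. pairs (E n)) (k i) (D i)" using J by blast
    then show "definable M (\<Union>i\<in>I. J i) (\<lambda>_. 2) (\<lambda>n. pairs (E n)) (k i) (D i)"
      by (rule definable_mono) (use i in blast)
  qed
  then show ?thesis by blast
qed

end
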